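(* Let $R$ be an integral domain with quotient field $K$, $R\neq K$. The following conditions are equivalent: (1) $R$ is a $w$-divisorial domain; (2) $R$ is a weakly Matlis domain and $R_M$ is a divisorial domain for each $t$-maximal ideal $M$ of $R$; (3) $R$ is a $TV$-domain and $R_M$ is a divisorial domain for each $t$-maximal ideal $M$ of $R$; (4) $IR_M=(IR_M)_v=I_vR_M$ for each nonzero fractional ideal $I$ of $R$ and each $t$-maximal ideal $M$ of $R$ (here $(IR_M)_v$ is computed in the domain $R_M$).
   Context: For a domain $D$ with quotient field $K\neq D$ and fractional ideals $I,J$, put $(J:I)=\{x\in K: xI\subseteq J\}$. For a nonzero fractional ideal $I$ of $D$: $I_v=(D:(D:I))$; $I_t=\bigcup J_v$, the union over nonzero finitely generated fractional ideals $J\subseteq I$. $I$ is divisorial if $I=I_v$, a $t$-ideal if $I=I_t$. A $t$-prime is a nonzero prime ideal that is a $t$-ideal; a $t$-maximal ideal is an ideal maximal among the proper integral $t$-ideals (it is prime). $t\text{-Max}(D)$ is the set of $t$-maximal ideals. $I_w=\bigcap_{M\in t\text{-Max}(D)}ID_M$, and $I$ is a $w$-ideal if $I=I_w$. $D$ is a divisorial domain if every nonzero ideal of $D$ is divisorial; a $w$-divisorial domain if every $w$-ideal of $D$ is divisorial (i.e. $I_w=I_v$ for every nonzero fractional ideal $I$); a $TV$-domain if every $t$-ideal is divisorial (i.e. $t=v$). $D$ is a weakly Matlis domain if each nonzero element of $D$ belongs to at most finitely many $t$-maximal ideals and each $t$-prime ideal is contained in a unique $t$-maximal ideal. *)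

theory Defs
  imports "HOL-Algebra.Ideal"
begin

text \<open>
  The quotient field \<open>K\<close> is a type of class \<open>field\<close>, and all rings and modules considered are
  subsets of it: a domain \<open>D\<close>, its localizations, its (fractional) ideals. The record
  \<open>ring_on D\<close> gives access to the predicates \<open>domain\<close>, \<open>ideal\<close>, \<open>primeideal\<close> for such subsets.
\<close>

definition ring_on :: "'a::field set \<Rightarrow> 'a ring" where
  "ring_on D = \<lparr>carrier = D, mult = (*), one = 1, zero = 0, add = (+)\<rparr>"

definition has_quotient_field_UNIV :: "'a::field set \<Rightarrow> bool" where
  "has_quotient_field_UNIV D \<longleftrightarrow> (\<forall>x. \<exists>a\<in>D. \<exists>b\<in>D. b \<noteq> 0 \<and> x = a / b)"

definition submodule_over :: "'a::field set \<Rightarrow> 'a set \<Rightarrow> bool" where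
  "submodule_over D N \<longleftrightarrow>
     0 \<in> N \<and> (\<forall>x\<in>N. \<forall>y\<in>N. x + y \<in> N) \<and> (\<forall>d\<in>D. \<forall>x\<in>N. d * x \<in> N)"

text \<open>
  The \<open>D\<close>-submodule generated by \<open>S\<close>. When \<open>S\<close> is an ideal \<open>I\<close> of a subring and \<open>D\<close> is a
  larger ring, its elements are the finite sums of products from \<open>D\<close> and \<open>I\<close>, so this is
  also the extension \<open>I D\<close>.
\<close>

definition span_over :: "'a::field set \<Rightarrow> 'a set \<Rightarrow> 'a set" where
  "span_over D S = {\<Sum>x\<in>T. c x * x | T c. finite T \<and> T \<subseteq> S \<and> c ` T \<subseteq> D}"

definition nonzero_fractional_ideal :: "'a::field set \<Rightarrow> 'a set \<Rightarrow> bool" where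
  "nonzero_fractional_ideal D I \<longleftrightarrow>
     submodule_over D I \<and> I \<noteq> {0} \<and> (\<exists>d\<in>D. d \<noteq> 0 \<and> (\<forall>x\<in>I. d * x \<in> D))"

definition finitely_generated_over :: "'a::field set \<Rightarrow> 'a set \<Rightarrow> bool" where
  "finitely_generated_over D I \<longleftrightarrow> (\<exists>S. finite S \<and> I = span_over D S)"

definition colon :: "'a::field set \<Rightarrow> 'a set \<Rightarrow> 'a set" where
  "colon J I = {x. \<forall>y\<in>I. x * y \<in> J}"

definition localization :: "'a::field set \<Rightarrow> 'a set \<Rightarrow> 'a set" where
  "localization D P = {a / s | a s. a \<in> D \<and> s \<in> D - P}"

definition v_closure :: "'a::field set \<Rightarrow> 'a set \<Rightarrow> 'a set" where
  "v_closure D I = colon D (colon D I)"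

definition t_closure :: "'a::field set \<Rightarrow> 'a set \<Rightarrow> 'a set" where
  "t_closure D I = \<Union> {v_closure D J | J.
     nonzero_fractional_ideal D J \<and> finitely_generated_over D J \<and> J \<subseteq> I}"

definition divisorial_ideal :: "'a::field set \<Rightarrow> 'a set \<Rightarrow> bool" where
  "divisorial_ideal D I \<longleftrightarrow> nonzero_fractional_ideal D I \<and> I = v_closure D I"

definition t_ideal :: "'a::field set \<Rightarrow> 'a set \<Rightarrow> bool" where
  "t_ideal D I \<longleftrightarrow> nonzero_fractional_ideal D I \<and> I = t_closure D I"

definition t_prime :: "'a::field set \<Rightarrow> 'a set \<Rightarrow> bool" where
  "t_prime D P \<longleftrightarrow> primeideal P (ring_on D) \<and> t_ideal D P"

definition proper_integral_t_ideal :: "'a::field set \<Rightarrow> 'a set \<Rightarrow> bool" where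
  "proper_integral_t_ideal D I \<longleftrightarrow> ideal I (ring_on D) \<and> I \<noteq> D \<and> t_ideal D I"

definition t_Max :: "'a::field set \<Rightarrow> 'a set set" where
  "t_Max D = {M. proper_integral_t_ideal D M \<and>
     (\<forall>J. proper_integral_t_ideal D J \<and> M \<subseteq> J \<longrightarrow> J = M)}"

definition w_closure :: "'a::field set \<Rightarrow> 'a set \<Rightarrow> 'a set" where
  "w_closure D I = (\<Inter>M\<in>t_Max D. span_over (localization D M) I)"

definition w_ideal :: "'a::field set \<Rightarrow> 'a set \<Rightarrow> bool" where
  "w_ideal D I \<longleftrightarrow> nonzero_fractional_ideal D I \<and> I = w_closure D I"

definition divisorial_domain :: "'a::field set \<Rightarrow> bool" where
  "divisorial_domain D \<longleftrightarrow> (\<forall>I. ideal I (ring_on D) \<and> I \<noteq> {0} \<longrightarrow> divisorial_ideal D I)"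

definition w_divisorial_domain :: "'a::field set \<Rightarrow> bool" where
  "w_divisorial_domain D \<longleftrightarrow> (\<forall>I. w_ideal D I \<longrightarrow> divisorial_ideal D I)"

definition TV_domain :: "'a::field set \<Rightarrow> bool" where
  "TV_domain D \<longleftrightarrow> (\<forall>I. t_ideal D I \<longrightarrow> divisorial_ideal D I)"

definition weakly_Matlis_domain :: "'a::field set \<Rightarrow> bool" where
  "weakly_Matlis_domain D \<longleftrightarrow>
     (\<forall>x\<in>D. x \<noteq> 0 \<longrightarrow> finite {M \<in> t_Max D. x \<in> M}) \<and>
     (\<forall>P. t_prime D P \<longrightarrow> (\<exists>!M. M \<in> t_Max D \<and> P \<subseteq> M))"

end

theory Submission
  imports Defs
begin

text \<open>
  Since \<open>I \<subseteq> I\<^sub>w \<subseteq> I\<^sub>t \<subseteq> I\<^sub>v\<close>, \<open>w\<close>-divisoriality means \<open>I\<^sub>v \<subseteq> I R\<^sub>M\<close> for all \<open>I\<close> and \<open>M\<close>, and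
  it implies \<open>t = v\<close>. The pivot is that, if \<open>t = v\<close>, then for each \<open>t\<close>-maximal \<open>N\<close> and
  \<open>0 \<noteq> x \<in> R\<close> some \<open>d \<in> R - N\<close> satisfies \<open>d (x\<^sup>-\<^sup>1 R \<inter> R\<^sub>N) \<subseteq> R\<close>; such a \<open>d\<close> lies in every other
  \<open>t\<close>-maximal ideal containing \<open>x\<close>. This gives finite character and, with \<open>(d\<^sup>2, x)\<^sub>v \<subseteq> (d\<^sup>2, x) R\<^sub>M\<close>,
  that no nonzero prime lies in two \<open>t\<close>-maximal ideals. In a weakly Matlis domain each element
  of \<open>K\<close> can be moved, by a factor outside \<open>M\<close>, into all \<open>R\<^sub>N\<close> with \<open>N \<noteq> M\<close>; thus elements of
  \<open>(R\<^sub>M : I R\<^sub>M)\<close> can be moved into \<open>(R : I)\<close>, so that divisoriality passes between \<open>R\<close> and the \<open>R\<^sub>M\<close>.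
\<close>

section \<open>Submodules of the quotient field\<close>

lemma colon_antimono: "S \<subseteq> T \<Longrightarrow> colon D T \<subseteq> colon D S"
  by (auto simp: colon_def)

lemma v_closure_mono: "S \<subseteq> T \<Longrightarrow> v_closure D S \<subseteq> v_closure D T"
  by (simp add: v_closure_def colon_antimono)

text \<open>Membership is tested against the multipliers of an arbitrary set \<open>S\<close>, so
  finite generating sets can stand in for finitely generated ideals throughout.\<close>

lemma v_closure_iff: "x \<in> v_closure D S \<longleftrightarrow> (\<forall>y. (\<forall>s\<in>S. y * s \<in> D) \<longrightarrow> x * y \<in> D)"
  by (auto simp: v_closure_def colon_def)

lemma subset_v_closure: "S \<subseteq> v_closure D S"
proof
  fix x assume "x \<in> S"
  then show "x \<in> v_closure D S"
    unfolding v_closure_iff by (simp add: mult.commute[of x])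
qed

text \<open>The colon into \<open>D\<close> is a Galois connection with itself: every
  \<open>y\<close> multiplying \<open>S\<close> into \<open>D\<close> also multiplies
  \<open>v_closure D S\<close> into \<open>D\<close>.\<close>

lemma v_closure_idem: "v_closure D (v_closure D S) = v_closure D S"
proof (rule equalityI[OF subsetI subset_v_closure])
  fix x assume x: "x \<in> v_closure D (v_closure D S)"
  show "x \<in> v_closure D S"
    unfolding v_closure_iff
  proof (intro allI impI)
    fix y assume y: "\<forall>s\<in>S. y * s \<in> D"
    have "\<forall>z\<in>v_closure D S. y * z \<in> D"
      using y unfolding Ball_def v_closure_iff by (simp add: mult.commute[of y])
    with x show "x * y \<in> D" unfolding v_closure_iff[of x] by blast
  qed
qed

lemma v_closure_least: "S \<subseteq> v_closure D T \<Longrightarrow> v_closure D S \<subseteq> v_closure D T"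
  using v_closure_mono[of S "v_closure D T" D] by (simp add: v_closure_idem)

text \<open>The multipliers of \<open>q S\<close> are those of \<open>S\<close> divided by
  \<open>q\<close>. This is used to replace a fractional ideal by an integral one.\<close>

lemma v_closure_scale:
  fixes q :: "'a::field"
  assumes "q \<noteq> 0"
  shows "v_closure D ((*) q ` S) = (*) q ` v_closure D S"
proof (intro equalityI subsetI)
  fix x assume x: "x \<in> v_closure D ((*) q ` S)"
  have "x / q \<in> v_closure D S"
    unfolding v_closure_iff
  proof (intro allI impI)
    fix y assume y: "\<forall>s\<in>S. y * s \<in> D"
    have "\<forall>s\<in>(*) q ` S. y / q * s \<in> D" using y assms by auto
    with x have "x * (y / q) \<in> D" unfolding v_closure_iff by blast
    then show "x / q * y \<in> D" by simp
  qed
  then show "x \<in> (*) q ` v_closure D S"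
    using assms by (intro image_eqI[of _ _ "x / q"]) auto
next
  fix x assume "x \<in> (*) q ` v_closure D S"
  then obtain z where z: "x = q * z" "z \<in> v_closure D S" by auto
  show "x \<in> v_closure D ((*) q ` S)"
    unfolding v_closure_iff
  proof (intro allI impI)
    fix y assume "\<forall>s\<in>(*) q ` S. y * s \<in> D"
    then have "\<forall>s\<in>S. (y * q) * s \<in> D" by (auto simp: mult.assoc)
    with z(2) have "z * (y * q) \<in> D" unfolding v_closure_iff by blast
    then show "x * y \<in> D" using z(1) by (simp add: ac_simps)
  qed
qed

lemma submodule_overD:
  assumes "submodule_over D N"
  shows "0 \<in> N"
    and "x \<in> N \<Longrightarrow> y \<in> N \<Longrightarrow> x + y \<in> N"
    and "d \<in> D \<Longrightarrow> x \<in> N \<Longrightarrow> d * x \<in> N"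
  using assms unfolding submodule_over_def by blast+

lemma submodule_over_sum:
  assumes "submodule_over D N" and "\<And>x. x \<in> T \<Longrightarrow> f x \<in> N"
  shows "(\<Sum>x\<in>T. f x) \<in> N"
  using assms(2)
proof (induction T rule: infinite_finite_induct)
  case (insert x F)
  with assms(1) show ?case by (auto simp: submodule_over_def)
qed (use assms(1) in \<open>auto simp: submodule_over_def\<close>)

lemma span_over_least:
  assumes "submodule_over D N" "S \<subseteq> N"
  shows "span_over D S \<subseteq> N"
  unfolding span_over_def
proof clarify
  fix T c assume "finite T" "T \<subseteq> S" "c ` T \<subseteq> D"
  then have "c x \<in> D \<and> x \<in> N" if "x \<in> T" for x using that assms(2) by auto
  then show "(\<Sum>x\<in>T. c x * x) \<in> N"
    using assms(1) by (intro submodule_over_sum[OF assms(1)]) (simp add: submodule_over_def)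
qed

lemma span_overI:
  "finite T \<Longrightarrow> T \<subseteq> S \<Longrightarrow> c ` T \<subseteq> D \<Longrightarrow> (\<Sum>x\<in>T. c x * x) \<in> span_over D S"
  unfolding span_over_def by blast

lemma span_over_mono: "S \<subseteq> T \<Longrightarrow> span_over D S \<subseteq> span_over D T"
  unfolding span_over_def by blast

text \<open>One locale serves \<open>R\<close> and its localizations alike: the latter enter as the
  sublocale \<open>loc\<close>, so that the facts proved here are available in both rings.\<close>

locale field_subring =
  fixes R :: "'k::field set"
  assumes zero_mem: "0 \<in> R"
    and one_mem: "1 \<in> R"
    and add_mem: "a \<in> R \<Longrightarrow> b \<in> R \<Longrightarrow> a + b \<in> R"
    and uminus_mem: "a \<in> R \<Longrightarrow> - a \<in> R"
    and mult_mem: "a \<in> R \<Longrightarrow> b \<in> R \<Longrightarrow> a * b \<in> R"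
begin

lemma diff_mem: "a \<in> R \<Longrightarrow> b \<in> R \<Longrightarrow> a - b \<in> R"
  using add_mem[of a "- b"] uminus_mem by simp

lemma cring_on: "cring (ring_on R)"
proof (rule cringI)
  show "abelian_group (ring_on R)"
  proof (rule abelian_groupI)
    fix x assume "x \<in> carrier (ring_on R)"
    then show "\<exists>y\<in>carrier (ring_on R). y \<oplus>\<^bsub>ring_on R\<^esub> x = \<zero>\<^bsub>ring_on R\<^esub>"
      by (intro bexI[of _ "- x"]) (auto simp: ring_on_def uminus_mem)
  qed (auto simp: ring_on_def zero_mem add_mem add.assoc add.commute)
  show "Group.comm_monoid (ring_on R)"
    by (rule comm_monoidI) (auto simp: ring_on_def one_mem mult_mem ac_simps)
qed (auto simp: ring_on_def algebra_simps)

lemma ideal_on_iff: "ideal I (ring_on R) \<longleftrightarrow> I \<subseteq> R \<and> submodule_over R I"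
proof
  assume "ideal I (ring_on R)"
  then interpret ideal I "ring_on R" .
  show "I \<subseteq> R \<and> submodule_over R I"
    using a_subset additive_subgroup.zero_closed[OF is_additive_subgroup]
      additive_subgroup.a_closed[OF is_additive_subgroup] I_l_closed
    by (auto simp: submodule_over_def ring_on_def)
next
  assume I: "I \<subseteq> R \<and> submodule_over R I"
  \<comment> \<open>\<open>submodule_over\<close> has no axiom for negatives; they come from
    multiplication by \<open>-1\<close>.\<close>
  have neg: "- x \<in> I" if "x \<in> I" for x
    using I that uminus_mem[OF one_mem] by (force simp: submodule_over_def)
  interpret cring "ring_on R" by (rule cring_on)
  have inv: "\<ominus>\<^bsub>ring_on R\<^esub> x = - x" if "x \<in> R" for x
    by (rule minus_equality) (use that uminus_mem in \<open>auto simp: ring_on_def\<close>)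
  show "ideal I (ring_on R)"
  proof (rule idealI)
    show "subgroup I (add_monoid (ring_on R))"
    proof (rule add.subgroupI)
      fix x assume "x \<in> I"
      then show "\<ominus>\<^bsub>ring_on R\<^esub> x \<in> I" using I inv neg by auto
    qed (use I in \<open>auto simp: submodule_over_def ring_on_def\<close>)
    have "r * x \<in> I \<and> x * r \<in> I" if "x \<in> I" "r \<in> R" for x r
      using that I submodule_overD(3)[of R I r x] by (simp add: mult.commute)
    then show "x \<otimes>\<^bsub>ring_on R\<^esub> a \<in> I" "a \<otimes>\<^bsub>ring_on R\<^esub> x \<in> I"
      if "a \<in> I" "x \<in> carrier (ring_on R)" for a x
      using that by (simp_all add: ring_on_def)
  qed (rule cring.axioms(1)[OF cring_on])
qed

lemma submodule_self: "submodule_over R R"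
  by (simp add: submodule_over_def zero_mem add_mem mult_mem)

lemma ideal_eq_iff_one:
  assumes "I \<subseteq> R" "submodule_over R I"
  shows "I = R \<longleftrightarrow> 1 \<in> I"
proof
  assume "1 \<in> I"
  then have "r \<in> I" if "r \<in> R" for r
    using assms(2) that unfolding submodule_over_def by (metis mult.right_neutral)
  with assms(1) show "I = R" by blast
qed (simp add: one_mem)

lemma primeideal_on_iff:
  "primeideal P (ring_on R) \<longleftrightarrow> P \<subseteq> R \<and> submodule_over R P \<and> 1 \<notin> P \<and>
     (\<forall>a\<in>R. \<forall>b\<in>R. a * b \<in> P \<longrightarrow> a \<in> P \<or> b \<in> P)"
proof
  assume "primeideal P (ring_on R)"
  then interpret primeideal P "ring_on R" .
  have "P \<subseteq> R \<and> submodule_over R P"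
    using ideal_axioms by (simp only: ideal_on_iff)
  then show "P \<subseteq> R \<and> submodule_over R P \<and> 1 \<notin> P \<and>
     (\<forall>a\<in>R. \<forall>b\<in>R. a * b \<in> P \<longrightarrow> a \<in> P \<or> b \<in> P)"
    using ideal_eq_iff_one[of P] I_notcarr I_prime by (auto simp: ring_on_def)
next
  assume P: "P \<subseteq> R \<and> submodule_over R P \<and> 1 \<notin> P \<and>
     (\<forall>a\<in>R. \<forall>b\<in>R. a * b \<in> P \<longrightarrow> a \<in> P \<or> b \<in> P)"
  show "primeideal P (ring_on R)"
  proof (rule primeidealI)
    show "ideal P (ring_on R)" using P by (simp add: ideal_on_iff)
    show "carrier (ring_on R) \<noteq> P" using P one_mem by (auto simp: ring_on_def)
  qed (use P in \<open>auto simp: ring_on_def intro: cring_on[unfolded ring_on_def]\<close>)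
qed

lemma submodule_span: "submodule_over R (span_over R S)"
  unfolding submodule_over_def
proof (intro conjI ballI)
  show "0 \<in> span_over R S"
    unfolding span_over_def by (auto intro!: exI[of _ "{}"])
next
  fix x y assume "x \<in> span_over R S" "y \<in> span_over R S"
  then obtain T c U d where
    *: "finite T" "T \<subseteq> S" "c ` T \<subseteq> R" "x = (\<Sum>t\<in>T. c t * t)"
       "finite U" "U \<subseteq> S" "d ` U \<subseteq> R" "y = (\<Sum>t\<in>U. d t * t)"
    unfolding span_over_def by blast
  \<comment> \<open>The values of \<open>c\<close> and \<open>d\<close> outside \<open>T\<close> and
    \<open>U\<close> are arbitrary, so each is cut off to 0 there before the coefficients are added
    on the union.\<close>
  define e where "e t = (if t \<in> T then c t else 0) + (if t \<in> U then d t else 0)" for t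
  have "(\<Sum>t\<in>T\<union>U. e t * t) =
      (\<Sum>t\<in>T\<union>U. if t \<in> T then c t * t else 0) + (\<Sum>t\<in>T\<union>U. if t \<in> U then d t * t else 0)"
    unfolding sum.distrib[symmetric] by (rule sum.cong) (auto simp: e_def algebra_simps)
  also have "\<dots> = x + y"
    using * by (simp add: sum.If_cases Int_absorb1 Int_absorb2)
  finally have "(\<Sum>t\<in>T\<union>U. e t * t) = x + y" .
  moreover have "e ` (T \<union> U) \<subseteq> R"
    using *(3,7) zero_mem by (auto simp: e_def image_subset_iff intro: add_mem)
  then have "(\<Sum>t\<in>T\<union>U. e t * t) \<in> span_over R S"
    using * by (intro span_overI) auto
  ultimately show "x + y \<in> span_over R S" by simp
next
  fix r x assume "r \<in> R" "x \<in> span_over R S"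
  then obtain T c where *: "finite T" "T \<subseteq> S" "c ` T \<subseteq> R" "x = (\<Sum>t\<in>T. c t * t)"
    unfolding span_over_def by blast
  have "r * x = (\<Sum>t\<in>T. (r * c t) * t)"
    using * by (simp add: sum_distrib_left mult.assoc)
  moreover have "(\<lambda>t. r * c t) ` T \<subseteq> R"
    using *(3) \<open>r \<in> R\<close> by (auto intro!: mult_mem)
  then have "(\<Sum>t\<in>T. (r * c t) * t) \<in> span_over R S"
    using * by (intro span_overI)
  ultimately show "r * x \<in> span_over R S" by simp
qed

lemma span_superset: "S \<subseteq> span_over R S"
proof
  fix x assume "x \<in> S"
  then show "x \<in> span_over R S"
    unfolding span_over_def
    by (auto intro!: exI[of _ "{x}"] exI[of _ "\<lambda>_. 1"] simp: one_mem)
qed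

lemma submodule_colon: "submodule_over R (colon R S)"
  using zero_mem add_mem mult_mem
  by (auto simp: submodule_over_def colon_def distrib_right mult.assoc)

lemma submodule_v_closure: "submodule_over R (v_closure R S)"
  unfolding v_closure_def by (rule submodule_colon)

text \<open>A v-closure is itself a submodule, so that of \<open>S\<close> already contains the span
  of \<open>S\<close>. Hence a finitely generated ideal has the v-closure of any finite generating
  set.\<close>

lemma v_closure_span: "v_closure R (span_over R S) = v_closure R S"
proof
  show "v_closure R (span_over R S) \<subseteq> v_closure R S"
    by (intro v_closure_least span_over_least submodule_v_closure subset_v_closure)
  show "v_closure R S \<subseteq> v_closure R (span_over R S)"
    by (rule v_closure_mono[OF span_superset])
qed

lemma v_closure_self: "v_closure R R = R"
proof (rule equalityI[OF subsetI subset_v_closure])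
  fix x assume "x \<in> v_closure R R"
  then have "x * 1 \<in> R" unfolding v_closure_iff by (metis mult_1)
  then show "x \<in> R" by simp
qed

lemma v_closure_subset: "S \<subseteq> R \<Longrightarrow> v_closure R S \<subseteq> R"
  using v_closure_mono[of S R R] by (simp add: v_closure_self)

end

section \<open>Localization at a prime ideal\<close>

locale prime_of_field_subring = field_subring R for R :: "'k::field set" +
  fixes P :: "'k set"
  assumes prime: "primeideal P (ring_on R)"
begin

lemma subset_ring: "P \<subseteq> R"
  and submodule: "submodule_over R P"
  and one_notin: "1 \<notin> P"
  and mult_cases: "a \<in> R \<Longrightarrow> b \<in> R \<Longrightarrow> a * b \<in> P \<Longrightarrow> a \<in> P \<or> b \<in> P"
  using prime unfolding primeideal_on_iff by auto

lemma mult_left: "r \<in> R \<Longrightarrow> p \<in> P \<Longrightarrow> r * p \<in> P"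
  by (rule submodule_overD(3)[OF submodule])

lemma compl_nonzero: "s \<in> R - P \<Longrightarrow> s \<noteq> 0"
  using submodule by (auto simp: submodule_over_def)

lemma one_compl: "1 \<in> R - P"
  using one_mem one_notin by simp

lemma mult_compl: "s \<in> R - P \<Longrightarrow> t \<in> R - P \<Longrightarrow> s * t \<in> R - P"
  using mult_cases mult_mem by blast

lemma mem_localization_iff: "x \<in> localization R P \<longleftrightarrow> (\<exists>s\<in>R - P. s * x \<in> R)"
proof
  assume "x \<in> localization R P"
  then obtain a s where "x = a / s" "a \<in> R" "s \<in> R - P" unfolding localization_def by blast
  with compl_nonzero show "\<exists>s\<in>R - P. s * x \<in> R" by (intro bexI[of _ s]) auto
next
  assume "\<exists>s\<in>R - P. s * x \<in> R"
  then obtain s where s: "s \<in> R - P" "s * x \<in> R" by blast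
  then have "x = (s * x) / s" using compl_nonzero by auto
  with s show "x \<in> localization R P" unfolding localization_def by blast
qed

lemma subset_localization: "R \<subseteq> localization R P"
  unfolding subset_iff mem_localization_iff using one_compl by (auto intro!: bexI[of _ 1])

lemma localization_superset_mem: "s \<in> R - P \<Longrightarrow> s * x \<in> R \<Longrightarrow> x \<in> localization R P"
  using mem_localization_iff by blast

lemma inverse_mem_localization: "s \<in> R - P \<Longrightarrow> inverse s \<in> localization R P"
  using compl_nonzero one_mem by (intro localization_superset_mem[of s]) auto

text \<open>The product of the finitely many multipliers works for all elements at once, since the
  complement of \<open>P\<close> is multiplicatively closed.\<close>

lemma common_denominator_submodule:
  assumes "submodule_over R I" "finite S" "\<And>x. x \<in> S \<Longrightarrow> \<exists>s\<in>R - P. s * x \<in> I"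
  shows "\<exists>s\<in>R - P. \<forall>x\<in>S. s * x \<in> I"
  using assms(2,3)
proof (induction S rule: finite_induct)
  case empty
  then show ?case using one_compl by auto
next
  case (insert y S)
  from insert obtain s t where s: "s \<in> R - P" "\<And>x. x \<in> S \<Longrightarrow> s * x \<in> I"
    and t: "t \<in> R - P" "t * y \<in> I" by blast
  have "(s * t) * x \<in> I" if "x \<in> insert y S" for x
  proof (cases "x = y")
    case True
    have "s * (t * y) \<in> I" using assms(1) s t unfolding submodule_over_def by blast
    with True show ?thesis by (simp add: mult.assoc)
  next
    case False
    with that have "t * (s * x) \<in> I" using assms(1) s t unfolding submodule_over_def by blast
    then show ?thesis by (simp add: ac_simps)
  qed
  then show ?case using mult_compl s(1) t(1) by blast
qed

lemma common_denominator:
  "finite S \<Longrightarrow> S \<subseteq> localization R P \<Longrightarrow> \<exists>s\<in>R - P. \<forall>x\<in>S. s * x \<in> R"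
  by (rule common_denominator_submodule[OF submodule_self]) (auto simp: mem_localization_iff)

lemma field_subring_localization: "field_subring (localization R P)"
proof
  fix a b assume a: "a \<in> localization R P" and b: "b \<in> localization R P"
  then have "\<exists>s\<in>R - P. \<forall>x\<in>{a, b}. s * x \<in> R"
    by (intro common_denominator) auto
  then obtain s where s: "s \<in> R - P" "s * a \<in> R" "s * b \<in> R" by auto
  show "a + b \<in> localization R P"
    using s add_mem by (intro localization_superset_mem[of s]) (auto simp: distrib_left)
  have "(s * a) * (s * b) \<in> R" using s mult_mem by blast
  then show "a * b \<in> localization R P"
    using s mult_compl by (intro localization_superset_mem[of "s * s"]) (auto simp: ac_simps)
next
  fix a assume "a \<in> localization R P"
  then show "- a \<in> localization R P"
    using uminus_mem unfolding mem_localization_iff by force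
qed (use subset_localization zero_mem one_mem in auto)

sublocale loc: field_subring "localization R P"
  by (rule field_subring_localization)

lemma divide_mem_localization:
  "a \<in> localization R P \<Longrightarrow> s \<in> R - P \<Longrightarrow> a / s \<in> localization R P"
  unfolding divide_inverse by (intro loc.mult_mem inverse_mem_localization)

text \<open>An element of the extension involves finitely many coefficients, and a common
  denominator of these moves it into \<open>I\<close>. Membership in the w-closure is computed in
  this form.\<close>

lemma mem_span_localization_iff:
  assumes "submodule_over R I"
  shows "x \<in> span_over (localization R P) I \<longleftrightarrow> (\<exists>s\<in>R - P. s * x \<in> I)"
proof
  assume "x \<in> span_over (localization R P) I"
  then obtain T c where T: "finite T" "T \<subseteq> I" "c ` T \<subseteq> localization R P" "x = (\<Sum>t\<in>T. c t * t)"
    unfolding span_over_def by blast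
  then obtain s where s: "s \<in> R - P" "\<forall>t\<in>T. s * c t \<in> R"
    using common_denominator[of "c ` T"] by auto
  have "s * x = (\<Sum>t\<in>T. (s * c t) * t)"
    using T by (simp add: sum_distrib_left mult.assoc)
  also have "\<dots> \<in> I"
    using s T assms by (intro submodule_over_sum[OF assms]) (auto simp: submodule_over_def)
  finally show "\<exists>s\<in>R - P. s * x \<in> I" using s by blast
next
  assume "\<exists>s\<in>R - P. s * x \<in> I"
  then obtain s where s: "s \<in> R - P" "s * x \<in> I" by blast
  have "inverse s * (s * x) \<in> span_over (localization R P) I"
    using inverse_mem_localization[OF s(1)] s(2) loc.span_superset loc.submodule_span
    unfolding submodule_over_def by blast
  then show "x \<in> span_over (localization R P) I"
    using compl_nonzero[OF s(1)] by (simp add: mult.assoc[symmetric])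
qed

text \<open>If \<open>y\<close> multiplies \<open>S\<close> into the localization, finiteness of
  \<open>S\<close> gives a single \<open>s\<close> outside \<open>P\<close> such that
  \<open>s y\<close> multiplies \<open>S\<close> into \<open>R\<close>.\<close>

lemma v_closure_subset_localization:
  assumes "finite S"
  shows "v_closure R S \<subseteq> v_closure (localization R P) S"
proof
  fix z assume z: "z \<in> v_closure R S"
  show "z \<in> v_closure (localization R P) S"
    unfolding v_closure_iff
  proof (intro allI impI)
    fix y assume y: "\<forall>s\<in>S. y * s \<in> localization R P"
    then obtain s where s: "s \<in> R - P" "\<forall>t\<in>S. s * (y * t) \<in> R"
      using common_denominator[of "(*) y ` S"] assms by auto
    then have "z * (s * y) \<in> R" using z unfolding v_closure_iff by (simp add: mult.assoc)
    then show "z * y \<in> localization R P"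
      using s by (intro localization_superset_mem[of s]) (auto simp: ac_simps)
  qed
qed

end

section \<open>The v-, t- and w-operations\<close>

locale fraction_domain = field_subring R for R :: "'k::field set" +
  assumes fractions: "has_quotient_field_UNIV R"
begin

lemma fraction_cases:
  obtains a b where "a \<in> R" "b \<in> R" "b \<noteq> 0" "x = a / b"
  using fractions unfolding has_quotient_field_UNIV_def by blast

lemma nonzero_fractional_idealD:
  assumes "nonzero_fractional_ideal R I"
  shows "submodule_over R I" and "\<exists>x\<in>I. x \<noteq> 0" and "\<exists>d\<in>R. d \<noteq> 0 \<and> (\<forall>x\<in>I. d * x \<in> R)"
  using assms unfolding nonzero_fractional_ideal_def submodule_over_def by blast+

lemma nonzero_fractional_idealI:
  assumes "submodule_over R J" "x \<in> J" "x \<noteq> 0" "nonzero_fractional_ideal R L" "J \<subseteq> L"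
  shows "nonzero_fractional_ideal R J"
  using assms unfolding nonzero_fractional_ideal_def by blast

lemma nonzero_fractional_ideal_self: "nonzero_fractional_ideal R R"
  using submodule_self one_mem unfolding nonzero_fractional_ideal_def by force

lemma nonzero_fractional_ideal_integral:
  "submodule_over R I \<Longrightarrow> I \<subseteq> R \<Longrightarrow> x \<in> I \<Longrightarrow> x \<noteq> 0 \<Longrightarrow> nonzero_fractional_ideal R I"
  using nonzero_fractional_idealI nonzero_fractional_ideal_self by blast

lemma nonzero_fractional_ideal_v_closure:
  assumes "nonzero_fractional_ideal R I"
  shows "nonzero_fractional_ideal R (v_closure R I)"
proof -
  obtain d where d: "d \<in> R" "d \<noteq> 0" "\<forall>x\<in>I. d * x \<in> R"
    using nonzero_fractional_idealD[OF assms] by blast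
  then have "\<forall>x\<in>v_closure R I. d * x \<in> R"
    unfolding v_closure_iff Ball_def by (simp add: mult.commute[of d])
  with d show ?thesis
    using submodule_v_closure[of I] subset_v_closure[of I R] nonzero_fractional_idealD(2)[OF assms]
    unfolding nonzero_fractional_ideal_def by blast
qed

section \<open>The t-closure in terms of finite subsets\<close>

lemma mem_t_closure_iff:
  assumes I: "nonzero_fractional_ideal R I"
  shows "x \<in> t_closure R I \<longleftrightarrow> (\<exists>S. finite S \<and> S \<subseteq> I \<and> x \<in> v_closure R S)"
proof
  assume "x \<in> t_closure R I"
  then obtain S where "finite S" "x \<in> v_closure R (span_over R S)" "span_over R S \<subseteq> I"
    unfolding t_closure_def finitely_generated_over_def by blast
  then show "\<exists>S. finite S \<and> S \<subseteq> I \<and> x \<in> v_closure R S"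
    using span_superset unfolding v_closure_span by blast
next
  assume "\<exists>S. finite S \<and> S \<subseteq> I \<and> x \<in> v_closure R S"
  then obtain S where S: "finite S" "S \<subseteq> I" "x \<in> v_closure R S" by blast
  \<comment> \<open>\<open>S\<close> may be empty or \<open>{0}\<close>; adjoining a nonzero
    \<open>i\<close> makes the generated ideal nonzero and can only enlarge the v-closure.\<close>
  obtain i where i: "i \<in> I" "i \<noteq> 0" using nonzero_fractional_idealD[OF I] by blast
  define J where "J = span_over R (insert i S)"
  have "J \<subseteq> I"
    unfolding J_def using S i nonzero_fractional_idealD[OF I] by (intro span_over_least) auto
  moreover have "i \<in> J" using span_superset unfolding J_def by blast
  ultimately have "nonzero_fractional_ideal R J"
    using nonzero_fractional_idealI[OF submodule_span] i I unfolding J_def by blast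
  moreover have "finitely_generated_over R J"
    unfolding finitely_generated_over_def J_def using S by blast
  moreover have "x \<in> v_closure R J"
    unfolding J_def v_closure_span using S v_closure_mono[of S "insert i S"] by blast
  ultimately show "x \<in> t_closure R I" using \<open>J \<subseteq> I\<close> unfolding t_closure_def by blast
qed

lemma t_ideal_iff:
  "t_ideal R I \<longleftrightarrow> nonzero_fractional_ideal R I \<and> (\<forall>S. finite S \<longrightarrow> S \<subseteq> I \<longrightarrow> v_closure R S \<subseteq> I)"
proof (cases "nonzero_fractional_ideal R I")
  case True
  have "I \<subseteq> t_closure R I"
  proof
    fix x assume "x \<in> I"
    then show "x \<in> t_closure R I"
      unfolding mem_t_closure_iff[OF True] using subset_v_closure by (intro exI[of _ "{x}"]) auto
  qed
  moreover have "t_closure R I \<subseteq> I \<longleftrightarrow> (\<forall>S. finite S \<longrightarrow> S \<subseteq> I \<longrightarrow> v_closure R S \<subseteq> I)"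
    unfolding subset_iff[of "t_closure R I"] mem_t_closure_iff[OF True] by blast
  ultimately show ?thesis using True unfolding t_ideal_def by blast
qed (simp add: t_ideal_def)

lemma t_idealD:
  assumes "t_ideal R I"
  shows "nonzero_fractional_ideal R I"
    and "submodule_over R I"
    and "\<exists>x\<in>I. x \<noteq> 0"
    and "finite S \<Longrightarrow> S \<subseteq> I \<Longrightarrow> v_closure R S \<subseteq> I"
proof -
  show I: "nonzero_fractional_ideal R I" using assms unfolding t_ideal_iff by (rule conjunct1)
  show "submodule_over R I" "\<exists>x\<in>I. x \<noteq> 0"
    using nonzero_fractional_idealD[OF I] by simp_all
  show "finite S \<Longrightarrow> S \<subseteq> I \<Longrightarrow> v_closure R S \<subseteq> I" using assms unfolding t_ideal_iff by simp
qed

lemma t_ideal_v_closure: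
  assumes "nonzero_fractional_ideal R I"
  shows "t_ideal R (v_closure R I)"
  unfolding t_ideal_iff
  using nonzero_fractional_ideal_v_closure[OF assms] v_closure_least by blast

lemma t_closure_subset_v_closure:
  "nonzero_fractional_ideal R I \<Longrightarrow> t_closure R I \<subseteq> v_closure R I"
  using mem_t_closure_iff v_closure_mono by blast

lemma subset_t_closure:
  assumes "nonzero_fractional_ideal R I"
  shows "I \<subseteq> t_closure R I"
proof
  fix x assume "x \<in> I"
  then show "x \<in> t_closure R I"
    unfolding mem_t_closure_iff[OF assms] using subset_v_closure by (intro exI[of _ "{x}"]) auto
qed

text \<open>Each element of a finite subset of the t-closure has a finite subset of \<open>I\<close>
  as witness. The union of these witnesses is again finite, and its v-closure contains the v-closure
  of the given subset. Closure under sums and multiples then follows from the v-closures of pairs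
  and singletons.\<close>

lemma t_ideal_t_closure:
  assumes I: "nonzero_fractional_ideal R I"
  shows "t_ideal R (t_closure R I)"
proof -
  have fin: "v_closure R S \<subseteq> t_closure R I" if S: "finite S" "S \<subseteq> t_closure R I" for S
  proof -
    have "\<forall>s\<in>S. \<exists>F. finite F \<and> F \<subseteq> I \<and> s \<in> v_closure R F"
      using S mem_t_closure_iff[OF I] by blast
    then obtain F where F: "\<And>s. s \<in> S \<Longrightarrow> finite (F s) \<and> F s \<subseteq> I \<and> s \<in> v_closure R (F s)"
      by metis
    have "S \<subseteq> v_closure R (\<Union>s\<in>S. F s)"
    proof
      fix s assume "s \<in> S"
      then show "s \<in> v_closure R (\<Union>s\<in>S. F s)"
        using F v_closure_mono[of "F s" "\<Union>s\<in>S. F s"] by blast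
    qed
    then have "v_closure R S \<subseteq> v_closure R (\<Union>s\<in>S. F s)"
      by (rule v_closure_least)
    moreover have "finite (\<Union>s\<in>S. F s)" "(\<Union>s\<in>S. F s) \<subseteq> I" using F S by auto
    ultimately show ?thesis using mem_t_closure_iff[OF I] by blast
  qed
  have "submodule_over R (t_closure R I)"
    unfolding submodule_over_def
  proof (intro conjI ballI)
    show "0 \<in> t_closure R I"
      using subset_t_closure[OF I] nonzero_fractional_idealD(1)[OF I]
      unfolding submodule_over_def by blast
  next
    fix x y assume "x \<in> t_closure R I" "y \<in> t_closure R I"
    then have "v_closure R {x, y} \<subseteq> t_closure R I" by (intro fin) auto
    moreover have "x + y \<in> v_closure R {x, y}"
      using submodule_v_closure[of "{x, y}"] subset_v_closure[of "{x, y}" R]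
      unfolding submodule_over_def by blast
    ultimately show "x + y \<in> t_closure R I" by blast
  next
    fix r x assume "r \<in> R" "x \<in> t_closure R I"
    then have "v_closure R {x} \<subseteq> t_closure R I" by (intro fin) auto
    moreover have "r * x \<in> v_closure R {x}"
      using submodule_v_closure[of "{x}"] subset_v_closure[of "{x}" R] \<open>r \<in> R\<close>
      unfolding submodule_over_def by blast
    ultimately show "r * x \<in> t_closure R I" by blast
  qed
  moreover obtain i where "i \<in> I" "i \<noteq> 0" using nonzero_fractional_idealD[OF I] by blast
  ultimately have "nonzero_fractional_ideal R (t_closure R I)"
    using nonzero_fractional_idealI nonzero_fractional_ideal_v_closure[OF I]
      t_closure_subset_v_closure[OF I] subset_t_closure[OF I] by blast
  with fin show ?thesis unfolding t_ideal_iff by blast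
qed

lemma t_ideal_self: "t_ideal R R"
  using t_ideal_v_closure[OF nonzero_fractional_ideal_self] by (simp add: v_closure_self)

text \<open>\<open>v_closure R {x}\<close> serves as the principal ideal \<open>x R\<close>; a
  denominator \<open>b\<close> of \<open>x\<close> shows that it is fractional.\<close>

lemma t_ideal_v_closure_singleton:
  assumes "x \<noteq> 0"
  shows "t_ideal R (v_closure R {x})"
proof -
  obtain a b where ab: "a \<in> R" "b \<in> R" "b \<noteq> 0" "x = a / b" by (rule fraction_cases)
  have "span_over R {x} \<subseteq> {z. b * z \<in> R}"
    using ab zero_mem add_mem mult_mem
    by (intro span_over_least) (auto simp: submodule_over_def distrib_left mult.left_commute)
  then have "nonzero_fractional_ideal R (span_over R {x})"
    using submodule_span[of "{x}"] span_superset[of "{x}"] ab(2,3) assms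
    unfolding nonzero_fractional_ideal_def by blast
  from t_ideal_v_closure[OF this] show ?thesis by (simp add: v_closure_span)
qed

lemma mem_v_closure_singletonD:
  assumes "z \<in> v_closure R {x}" "x \<noteq> 0"
  shows "z / x \<in> R"
proof -
  have "\<forall>s\<in>{x}. inverse x * s \<in> R" using assms(2) one_mem by simp
  with assms(1) show ?thesis unfolding v_closure_iff by (metis divide_inverse)
qed

section \<open>Maximal t-ideals disjoint from a set, and their primality\<close>

text \<open>Zorn's lemma applies because t-ideals are tested on finite subsets: a finite subset of
  the union of a chain lies in one member, and so does its v-closure. The choice
  \<open>S = {1}\<close> yields t-maximal ideals, larger multiplicative sets yield t-primes.\<close>

lemma exists_maximal_t_ideal:
  assumes "t_ideal R I" "I \<subseteq> R" "I \<inter> S = {}"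
  obtains Q where "t_ideal R Q" "I \<subseteq> Q" "Q \<subseteq> R" "Q \<inter> S = {}"
    "\<And>J. t_ideal R J \<Longrightarrow> J \<subseteq> R \<Longrightarrow> J \<inter> S = {} \<Longrightarrow> Q \<subseteq> J \<Longrightarrow> J = Q"
proof -
  define A where "A = {J. t_ideal R J \<and> I \<subseteq> J \<and> J \<subseteq> R \<and> J \<inter> S = {}}"
  have "\<exists>M\<in>A. \<forall>X\<in>A. M \<subseteq> X \<longrightarrow> X = M"
  proof (rule subset_Zorn_nonempty)
    show "A \<noteq> {}" using assms unfolding A_def by blast
  next
    fix C assume ne: "C \<noteq> {}" and chain: "subset.chain A C"
    then have CA: "C \<subseteq> A" unfolding subset_chain_def by blast
    have fin: "\<exists>B\<in>C. T \<subseteq> B" if "finite T" "T \<subseteq> \<Union>C" for T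
      using finite_subset_Union_chain[OF that ne chain] by blast
    obtain B0 where B0: "B0 \<in> C" using ne by blast
    have sub: "submodule_over R B" if "B \<in> C" for B
      using that CA by (intro t_idealD(2)) (auto simp: A_def)
    have "submodule_over R (\<Union>C)"
      unfolding submodule_over_def
    proof (intro conjI ballI)
      show "0 \<in> \<Union>C" using sub[OF B0] B0 unfolding submodule_over_def by blast
    next
      fix x y assume "x \<in> \<Union>C" "y \<in> \<Union>C"
      then obtain B where "B \<in> C" "x \<in> B" "y \<in> B" using fin[of "{x, y}"] by auto
      then show "x + y \<in> \<Union>C" using sub unfolding submodule_over_def by blast
    next
      fix r x assume "r \<in> R" "x \<in> \<Union>C"
      then show "r * x \<in> \<Union>C" using sub unfolding submodule_over_def by blast
    qed
    moreover have "\<Union>C \<subseteq> R" using CA unfolding A_def by blast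
    moreover obtain x where "x \<in> B0" "x \<noteq> 0"
      using B0 CA t_idealD(3)[of B0] unfolding A_def by blast
    ultimately have "nonzero_fractional_ideal R (\<Union>C)"
      using B0 nonzero_fractional_ideal_integral by blast
    moreover have "v_closure R T \<subseteq> \<Union>C" if fT: "finite T" "T \<subseteq> \<Union>C" for T
    proof -
      obtain B where "B \<in> C" "T \<subseteq> B" using fin[OF fT] by blast
      moreover then have "t_ideal R B" using CA unfolding A_def by blast
      ultimately show ?thesis using fT(1) t_idealD(4)[of B T] by blast
    qed
    ultimately have "t_ideal R (\<Union>C)" unfolding t_ideal_iff by blast
    then show "\<Union>C \<in> A" using CA B0 unfolding A_def by blast
  qed
  then obtain Q where "Q \<in> A" and max: "\<And>X. X \<in> A \<Longrightarrow> Q \<subseteq> X \<Longrightarrow> X = Q" by blast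
  then have Q: "t_ideal R Q" "I \<subseteq> Q" "Q \<subseteq> R" "Q \<inter> S = {}" by (simp_all add: A_def)
  show ?thesis
  proof (rule that[OF Q])
    fix J assume "t_ideal R J" "J \<subseteq> R" "J \<inter> S = {}" "Q \<subseteq> J"
    then show "J = Q" using Q(2) by (intro max) (auto simp: A_def)
  qed
qed

text \<open>If \<open>a\<close> and \<open>b\<close> are outside \<open>Q\<close>, maximality makes
  the t-closures of \<open>Q + a R\<close> and \<open>Q + b R\<close> meet \<open>S\<close> in
  elements \<open>u\<close> and \<open>v\<close>. If also \<open>a b\<close> is in \<open>Q\<close>,
  the product of the two ideals lies in \<open>Q\<close>, which forces \<open>u v\<close> into
  \<open>Q\<close> although it belongs to \<open>S\<close>.\<close>

lemma maximal_t_ideal_prime: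
  assumes S: "1 \<in> S" "S \<subseteq> R" "\<And>u v. u \<in> S \<Longrightarrow> v \<in> S \<Longrightarrow> u * v \<in> S"
    and Q: "t_ideal R Q" "Q \<subseteq> R" "Q \<inter> S = {}"
    and max: "\<And>J. t_ideal R J \<Longrightarrow> J \<subseteq> R \<Longrightarrow> J \<inter> S = {} \<Longrightarrow> Q \<subseteq> J \<Longrightarrow> J = Q"
  shows "primeideal Q (ring_on R)"
proof -
  have subm: "submodule_over R Q"
    using Q(1) by (rule t_idealD)
  obtain q0 where q0: "q0 \<in> Q" "q0 \<noteq> 0"
    using t_idealD(3)[OF Q(1)] by blast
  have meet: "\<exists>F u. finite F \<and> F \<subseteq> span_over R (insert c Q) \<and> u \<in> S \<and> u \<in> v_closure R F"
    if c: "c \<in> R" "c \<notin> Q" for c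
  proof -
    let ?I = "span_over R (insert c Q)"
    have IR: "?I \<subseteq> R" using c Q by (intro span_over_least submodule_self) auto
    have QI: "insert c Q \<subseteq> ?I" by (rule span_superset)
    then have I: "nonzero_fractional_ideal R ?I"
      using nonzero_fractional_ideal_integral[OF submodule_span IR] q0 by blast
    have "t_closure R ?I \<subseteq> R"
      using t_closure_subset_v_closure[OF I] v_closure_subset[OF IR] by blast
    moreover have "insert c Q \<subseteq> t_closure R ?I" using QI subset_t_closure[OF I] by blast
    ultimately have "t_closure R ?I \<inter> S \<noteq> {}"
      using max[OF t_ideal_t_closure[OF I]] c by blast
    then show ?thesis using mem_t_closure_iff[OF I] by blast
  qed
  have "a \<in> Q \<or> b \<in> Q" if ab: "a \<in> R" "b \<in> R" "a * b \<in> Q" for a b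
  proof (rule ccontr)
    assume "\<not> (a \<in> Q \<or> b \<in> Q)"
    then obtain F G u v where
      F: "finite F" "F \<subseteq> span_over R (insert a Q)" "u \<in> S" "u \<in> v_closure R F" and
      G: "finite G" "G \<subseteq> span_over R (insert b Q)" "v \<in> S" "v \<in> v_closure R G"
      using meet[OF ab(1)] meet[OF ab(2)] by auto
    \<comment> \<open>Bilinearity is handled one factor at a time: first all \<open>f\<close> from
      \<open>Q + a R\<close> satisfy that \<open>f b\<close> is in \<open>Q\<close>, then all
      \<open>g\<close> from \<open>Q + b R\<close> are multiplied into \<open>Q\<close> by such
      \<open>f\<close>.\<close>
    have "submodule_over R {f \<in> R. f * b \<in> Q}"
      using subm submodule_self unfolding submodule_over_def
      by (simp add: distrib_right mult.assoc)
    then have "span_over R (insert a Q) \<subseteq> {f \<in> R. f * b \<in> Q}"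
      using ab Q(2) submodule_overD(3)[OF subm ab(2)]
      by (intro span_over_least) (auto simp: mult.commute[of _ b])
    moreover have "span_over R (insert b Q) \<subseteq> {g. \<forall>f\<in>{f \<in> R. f * b \<in> Q}. f * g \<in> Q}"
    proof (rule span_over_least)
      show "submodule_over R {g. \<forall>f\<in>{f \<in> R. f * b \<in> Q}. f * g \<in> Q}"
        unfolding submodule_over_def
      proof (intro conjI ballI CollectI)
        fix r g f assume "r \<in> R" "g \<in> {g. \<forall>f\<in>{f \<in> R. f * b \<in> Q}. f * g \<in> Q}"
          and "f \<in> {f \<in> R. f * b \<in> Q}"
        then have "r * (f * g) \<in> Q" using submodule_overD(3)[OF subm] by blast
        then show "f * (r * g) \<in> Q" by (simp add: mult.left_commute)
      qed (use submodule_overD[OF subm] in \<open>simp_all add: distrib_left\<close>)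
      show "insert b Q \<subseteq> {g. \<forall>f\<in>{f \<in> R. f * b \<in> Q}. f * g \<in> Q}"
        using submodule_overD(3)[OF subm] by blast
    qed
    ultimately have "f * g \<in> Q" if "f \<in> F" "g \<in> G" for f g
      using that subsetD[OF F(2)] subsetD[OF G(2)] by blast
    then have "(\<lambda>(f, g). f * g) ` (F \<times> G) \<subseteq> Q" by auto
    moreover have "finite ((\<lambda>(f, g). f * g) ` (F \<times> G))" using F G by blast
    ultimately have "v_closure R ((\<lambda>(f, g). f * g) ` (F \<times> G)) \<subseteq> Q"
      using t_idealD(4)[OF Q(1)] by blast
    \<comment> \<open>A multiplier \<open>y\<close> of all products \<open>f g\<close> is moved
      across in two stages: \<open>G\<close> is replaced by \<open>v\<close> for each fixed
      \<open>f\<close>, then \<open>F\<close> by \<open>u\<close>.\<close>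
    moreover have "u * v \<in> v_closure R ((\<lambda>(f, g). f * g) ` (F \<times> G))"
      unfolding v_closure_iff
    proof (intro allI impI)
      fix y assume y: "\<forall>s\<in>(\<lambda>(f, g). f * g) ` (F \<times> G). y * s \<in> R"
      have "(y * v) * f \<in> R" if "f \<in> F" for f
      proof -
        have "\<forall>g\<in>G. (y * f) * g \<in> R" using y that by (auto simp: mult.assoc)
        then have "v * (y * f) \<in> R" using G(4) unfolding v_closure_iff by blast
        then show ?thesis by (simp add: ac_simps)
      qed
      then have "u * (y * v) \<in> R" using F(4) unfolding v_closure_iff by blast
      then show "u * v * y \<in> R" by (simp add: ac_simps)
    qed
    ultimately show False using S(3)[OF F(3) G(3)] Q(3) by blast
  qed
  then show ?thesis using subm Q S(1) unfolding primeideal_on_iff by blast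
qed

section \<open>t-maximal ideals\<close>

lemma t_Max_iff:
  "M \<in> t_Max R \<longleftrightarrow> t_ideal R M \<and> M \<subseteq> R \<and> 1 \<notin> M \<and>
     (\<forall>J. t_ideal R J \<and> J \<subseteq> R \<and> 1 \<notin> J \<and> M \<subseteq> J \<longrightarrow> J = M)"
proof -
  have "proper_integral_t_ideal R I \<longleftrightarrow> t_ideal R I \<and> I \<subseteq> R \<and> 1 \<notin> I" for I
    using ideal_eq_iff_one[of I] nonzero_fractional_idealD(1)[of I]
    unfolding proper_integral_t_ideal_def ideal_on_iff t_ideal_def by blast
  then show ?thesis unfolding t_Max_def by blast
qed

lemma t_MaxD:
  assumes "M \<in> t_Max R"
  shows "t_ideal R M" "M \<subseteq> R" "1 \<notin> M"
  using assms unfolding t_Max_iff by blast+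

lemma t_Max_maximal:
  "M \<in> t_Max R \<Longrightarrow> t_ideal R J \<Longrightarrow> J \<subseteq> R \<Longrightarrow> 1 \<notin> J \<Longrightarrow> M \<subseteq> J \<Longrightarrow> J = M"
  unfolding t_Max_iff by blast

lemma t_Max_prime: "M \<in> t_Max R \<Longrightarrow> primeideal M (ring_on R)"
  by (rule maximal_t_ideal_prime[of "{1}"])
    (use t_MaxD t_Max_maximal one_mem in \<open>simp_all\<close>)

lemma t_Max_locale: "M \<in> t_Max R \<Longrightarrow> prime_of_field_subring R M"
  by (simp add: field_subring_axioms prime_of_field_subring.intro prime_of_field_subring_axioms.intro
      t_Max_prime)

lemma exists_t_Max_superset:
  assumes "t_ideal R I" "I \<subseteq> R" "1 \<notin> I"
  shows "\<exists>M\<in>t_Max R. I \<subseteq> M"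
proof -
  have "I \<inter> {1} = {}" using assms(3) by blast
  then obtain Q where "t_ideal R Q" "I \<subseteq> Q" "Q \<subseteq> R" "Q \<inter> {1} = {}"
    "\<And>J. t_ideal R J \<Longrightarrow> J \<subseteq> R \<Longrightarrow> J \<inter> {1} = {} \<Longrightarrow> Q \<subseteq> J \<Longrightarrow> J = Q"
    using exists_maximal_t_ideal[OF assms(1,2)] by metis
  then show ?thesis by (intro bexI[of _ Q]) (auto simp: t_Max_iff)
qed

lemma t_Max_antichain: "M \<in> t_Max R \<Longrightarrow> N \<in> t_Max R \<Longrightarrow> M \<subseteq> N \<Longrightarrow> M = N"
  using t_Max_maximal t_MaxD by metis

text \<open>The t-closure of \<open>A\<close> is an integral t-ideal; if it omitted 1, some
  t-maximal ideal would contain it and thus \<open>A\<close>.\<close>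

lemma one_in_v_closure_finite:
  assumes "nonzero_fractional_ideal R A" "A \<subseteq> R" "\<And>M. M \<in> t_Max R \<Longrightarrow> \<not> A \<subseteq> M"
  shows "\<exists>S. finite S \<and> S \<subseteq> A \<and> 1 \<in> v_closure R S"
proof -
  have "t_closure R A \<subseteq> R"
    using t_closure_subset_v_closure[OF assms(1)] v_closure_subset[OF assms(2)] by blast
  then have "1 \<in> t_closure R A"
    using exists_t_Max_superset[OF t_ideal_t_closure[OF assms(1)]] assms(3)
      subset_t_closure[OF assms(1)] by blast
  then show ?thesis using mem_t_closure_iff[OF assms(1)] by blast
qed

section \<open>The w-operation and its comparison with t and v\<close>

lemma mem_w_closure_iff:
  assumes "submodule_over R I"
  shows "x \<in> w_closure R I \<longleftrightarrow> (\<forall>M\<in>t_Max R. \<exists>s\<in>R - M. s * x \<in> I)"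
  using prime_of_field_subring.mem_span_localization_iff[OF t_Max_locale assms]
  unfolding w_closure_def by blast

lemma subset_w_closure:
  assumes "submodule_over R I"
  shows "I \<subseteq> w_closure R I"
  unfolding subset_iff mem_w_closure_iff[OF assms]
  using one_mem t_MaxD(3) by (auto intro!: bexI[of _ 1])

text \<open>The ideal \<open>A\<close> of all \<open>r\<close> in \<open>R\<close> with
  \<open>r x\<close> in \<open>I\<close> lies in no t-maximal ideal, so 1 is in the v-closure of a
  finite part of \<open>A\<close>. Multiplying that part by \<open>x\<close> gives the required
  subset of \<open>I\<close>.\<close>

lemma mem_w_closure_finite:
  assumes I: "nonzero_fractional_ideal R I" and x: "x \<in> w_closure R I"
  shows "\<exists>S. finite S \<and> S \<subseteq> I \<and> x \<in> v_closure R S"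
proof -
  note subm = nonzero_fractional_idealD(1)[OF I]
  define A where "A = {r \<in> R. r * x \<in> I}"
  have A: "submodule_over R A"
    using subm submodule_self unfolding A_def submodule_over_def
    by (auto simp: distrib_right mult.assoc)
  obtain i where i: "i \<in> I" "i \<noteq> 0" using nonzero_fractional_idealD[OF I] by blast
  obtain a b where ab: "a \<in> R" "b \<in> R" "b \<noteq> 0" "i = a / b" by (rule fraction_cases)
  obtain c e where ce: "c \<in> R" "e \<in> R" "e \<noteq> 0" "x = c / e" by (rule fraction_cases)
  \<comment> \<open>The denominators of \<open>i\<close> and \<open>x\<close> exhibit a nonzero
    element \<open>a e\<close> of \<open>A\<close>: both \<open>(a e) x\<close> and
    \<open>(b c) i\<close> equal \<open>a c\<close>.\<close>
  have "(b * c) * i \<in> I" using subm i(1) ab ce mult_mem unfolding submodule_over_def by blast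
  moreover have "(a * e) * x = (b * c) * i" using ab ce by (simp add: field_simps)
  ultimately have "(a * e) * x \<in> I" by simp
  then have "a * e \<in> A" using ab ce mult_mem unfolding A_def by blast
  moreover have "a * e \<noteq> 0" using i ab ce by auto
  ultimately have "nonzero_fractional_ideal R A"
    using nonzero_fractional_ideal_integral[OF A] unfolding A_def by blast
  moreover have "\<not> A \<subseteq> M" if "M \<in> t_Max R" for M
    using x that unfolding mem_w_closure_iff[OF subm] A_def by blast
  ultimately obtain S where S: "finite S" "S \<subseteq> A" "1 \<in> v_closure R S"
    using one_in_v_closure_finite[of A] unfolding A_def by blast
  have "x \<in> v_closure R ((\<lambda>s. s * x) ` S)"
    unfolding v_closure_iff
  proof (intro allI impI)
    fix y assume "\<forall>s\<in>(\<lambda>s. s * x) ` S. y * s \<in> R"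
    then have "\<forall>s\<in>S. (x * y) * s \<in> R" by (auto simp: ac_simps)
    then have "1 * (x * y) \<in> R" using S(3) unfolding v_closure_iff by blast
    then show "x * y \<in> R" by simp
  qed
  then show ?thesis using S(1,2) unfolding A_def by (intro exI[of _ "(\<lambda>s. s * x) ` S"]) auto
qed

lemma w_closure_subset_t_ideal:
  assumes "t_ideal R I"
  shows "w_closure R I \<subseteq> I"
proof
  fix x assume "x \<in> w_closure R I"
  then obtain S where "finite S" "S \<subseteq> I" "x \<in> v_closure R S"
    using mem_w_closure_finite[OF t_idealD(1)[OF assms]] by blast
  then show "x \<in> I" using t_idealD(4)[OF assms] by blast
qed

lemma w_closure_mono: "I \<subseteq> J \<Longrightarrow> w_closure R I \<subseteq> w_closure R J"
  unfolding w_closure_def by (intro INF_superset_mono span_over_mono order_refl)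

lemma w_closure_subset_v_closure:
  assumes "nonzero_fractional_ideal R I"
  shows "w_closure R I \<subseteq> v_closure R I"
  using w_closure_subset_t_ideal[OF t_ideal_v_closure[OF assms]]
    w_closure_mono[OF subset_v_closure[of I R]] by blast

text \<open>\<open>R\<close> is itself a t-ideal and therefore equal to its w-closure, which is the
  intersection of the localizations.\<close>

lemma mem_ring_iff_localizations:
  "x \<in> R \<longleftrightarrow> (\<forall>M\<in>t_Max R. x \<in> localization R M)"
proof -
  have "w_closure R R = R"
    using w_closure_subset_t_ideal[OF t_ideal_self] subset_w_closure[OF submodule_self] by blast
  then show ?thesis
    using mem_w_closure_iff[OF submodule_self, of x]
      prime_of_field_subring.mem_localization_iff[OF t_Max_locale, of _ x] by simp
qed

lemma submodule_w_closure:
  assumes "submodule_over R I"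
  shows "submodule_over R (w_closure R I)"
  unfolding submodule_over_def
proof (intro conjI ballI)
  show "0 \<in> w_closure R I"
    using subset_w_closure[OF assms] assms unfolding submodule_over_def by blast
next
  fix x y assume xy: "x \<in> w_closure R I" "y \<in> w_closure R I"
  show "x + y \<in> w_closure R I"
    unfolding mem_w_closure_iff[OF assms]
  proof
    fix M assume M: "M \<in> t_Max R"
    then interpret prime_of_field_subring R M by (rule t_Max_locale)
    have "\<exists>s\<in>R - M. \<forall>z\<in>{x, y}. s * z \<in> I"
      using xy M unfolding mem_w_closure_iff[OF assms]
      by (intro common_denominator_submodule assms) auto
    then show "\<exists>s\<in>R - M. s * (x + y) \<in> I"
      using assms unfolding submodule_over_def by (auto simp: distrib_left)
  qed
next
  fix r x assume "r \<in> R" "x \<in> w_closure R I"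
  then show "r * x \<in> w_closure R I"
    using assms unfolding mem_w_closure_iff[OF assms] submodule_over_def
    by (metis mult.left_commute)
qed

lemma w_ideal_w_closure:
  assumes I: "nonzero_fractional_ideal R I"
  shows "w_ideal R (w_closure R I)"
proof -
  note subm = nonzero_fractional_idealD(1)[OF I]
  note wsubm = submodule_w_closure[OF subm]
  have "w_closure R (w_closure R I) \<subseteq> w_closure R I"
  proof
    fix x assume x: "x \<in> w_closure R (w_closure R I)"
    show "x \<in> w_closure R I"
      unfolding mem_w_closure_iff[OF subm]
    proof
      fix M assume M: "M \<in> t_Max R"
      then interpret prime_of_field_subring R M by (rule t_Max_locale)
      obtain s where s: "s \<in> R - M" "s * x \<in> w_closure R I"
        using x M unfolding mem_w_closure_iff[OF wsubm] by blast
      then obtain t where "t \<in> R - M" "t * (s * x) \<in> I"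
        using M unfolding mem_w_closure_iff[OF subm] by blast
      then show "\<exists>s\<in>R - M. s * x \<in> I"
        using s mult_compl by (intro bexI[of _ "t * s"]) (auto simp: mult.assoc)
    qed
  qed
  moreover obtain i where "i \<in> I" "i \<noteq> 0" using nonzero_fractional_idealD[OF I] by blast
  then have "nonzero_fractional_ideal R (w_closure R I)"
    using nonzero_fractional_idealI[OF wsubm] subset_w_closure[OF subm]
      nonzero_fractional_ideal_v_closure[OF I] w_closure_subset_v_closure[OF I] by blast
  ultimately show ?thesis using subset_w_closure[OF wsubm] unfolding w_ideal_def by blast
qed

text \<open>The w-closure of \<open>I\<close> is a w-ideal containing \<open>I\<close>; once it is
  divisorial, it must contain the v-closure of \<open>I\<close>.\<close>

lemma w_divisorial_domain_iff:
  "w_divisorial_domain R \<longleftrightarrow>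
     (\<forall>I. nonzero_fractional_ideal R I \<longrightarrow> v_closure R I \<subseteq> w_closure R I)"
proof
  assume *: "w_divisorial_domain R"
  show "\<forall>I. nonzero_fractional_ideal R I \<longrightarrow> v_closure R I \<subseteq> w_closure R I"
  proof (intro allI impI)
    fix I assume I: "nonzero_fractional_ideal R I"
    have "w_closure R I = v_closure R (w_closure R I)"
      using * w_ideal_w_closure[OF I]
      unfolding w_divisorial_domain_def divisorial_ideal_def by blast
    then show "v_closure R I \<subseteq> w_closure R I"
      using v_closure_mono subset_w_closure nonzero_fractional_idealD(1)[OF I] by metis
  qed
next
  assume "\<forall>I. nonzero_fractional_ideal R I \<longrightarrow> v_closure R I \<subseteq> w_closure R I"
  then show "w_divisorial_domain R"
    using subset_v_closure
    unfolding w_divisorial_domain_def w_ideal_def divisorial_ideal_def by blast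
qed

text \<open>Every t-ideal equals its w-closure, so it is among the ideals assumed to be
  divisorial.\<close>

lemma w_divisorial_imp_TV:
  assumes "w_divisorial_domain R"
  shows "TV_domain R"
  unfolding TV_domain_def
proof (intro allI impI)
  fix I assume I: "t_ideal R I"
  then have "nonzero_fractional_ideal R I" unfolding t_ideal_def by blast
  moreover have "I = w_closure R I"
    using w_closure_subset_t_ideal[OF I] subset_w_closure nonzero_fractional_idealD(1)[OF calculation]
    by blast
  ultimately show "divisorial_ideal R I"
    using assms unfolding w_divisorial_domain_def w_ideal_def by blast
qed

section \<open>Finite character and independence\<close>

text \<open>Since \<open>M\<close> is divisorial and proper, some \<open>y\<close> outside
  \<open>R\<close> multiplies \<open>M\<close> into \<open>R\<close>. The ideal of all
  \<open>s\<close> in \<open>R\<close> with \<open>s y\<close> in \<open>R\<close> is then a proper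
  t-ideal containing \<open>M\<close>, so maximality identifies it with \<open>M\<close>.\<close>

lemma t_Max_witness:
  assumes TV: "TV_domain R" and M: "M \<in> t_Max R"
  obtains y where "y \<notin> R" "\<And>m. m \<in> M \<Longrightarrow> y * m \<in> R" "\<And>s. s \<in> R \<Longrightarrow> s * y \<in> R \<Longrightarrow> s \<in> M"
proof -
  have "M = v_closure R M"
    using TV t_MaxD(1)[OF M] unfolding TV_domain_def divisorial_ideal_def by blast
  then have "1 \<notin> v_closure R M" using t_MaxD(3)[OF M] by simp
  then obtain y where y: "\<forall>m\<in>M. y * m \<in> R" "y \<notin> R"
    unfolding v_closure_iff by auto
  define A where "A = {s \<in> R. s * y \<in> R}"
  have sub: "submodule_over R A"
    using submodule_self unfolding A_def submodule_over_def
    by (simp add: distrib_right mult.assoc)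
  have MA: "M \<subseteq> A" using y(1) t_MaxD(2)[OF M] by (auto simp: A_def mult.commute)
  have AR: "A \<subseteq> R" by (auto simp: A_def)
  obtain m where "m \<in> M" "m \<noteq> 0" using t_idealD(3)[OF t_MaxD(1)[OF M]] by blast
  then have "nonzero_fractional_ideal R A"
    using MA nonzero_fractional_ideal_integral[OF sub AR] by blast
  moreover have "v_closure R S \<subseteq> A" if "S \<subseteq> A" for S
  proof
    fix z assume z: "z \<in> v_closure R S"
    have "\<forall>s\<in>S. y * s \<in> R" using that by (auto simp: A_def mult.commute)
    then have "z * y \<in> R" using z unfolding v_closure_iff by blast
    then show "z \<in> A" using z v_closure_subset[of S] that AR unfolding A_def by blast
  qed
  ultimately have "t_ideal R A" unfolding t_ideal_iff by blast
  moreover have "1 \<notin> A" using y(2) by (simp add: A_def)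
  ultimately have "A = M" using t_Max_maximal[OF M _ AR _ MA] by blast
  then show ?thesis using that[of y] y by (auto simp: A_def)
qed

text \<open>With \<open>t = v\<close>, each element of the v-closure comes from a finite subset of
  \<open>I\<close>, whose denominators are cleared by one \<open>s\<close> outside
  \<open>P\<close>.\<close>

lemma v_closure_subset_localization_TV:
  assumes TV: "TV_domain R" and I: "nonzero_fractional_ideal R I"
    and P: "prime_of_field_subring R P" and sub: "I \<subseteq> localization R P"
  shows "v_closure R I \<subseteq> localization R P"
proof
  interpret prime_of_field_subring R P by (rule P)
  fix z assume z: "z \<in> v_closure R I"
  have "t_closure R I = v_closure R (t_closure R I)"
    using TV t_ideal_t_closure[OF I] unfolding TV_domain_def divisorial_ideal_def by blast
  then have "z \<in> t_closure R I"
    using z v_closure_mono[OF subset_t_closure[OF I], of R] by blast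
  then obtain S where S: "finite S" "S \<subseteq> I" "z \<in> v_closure R S"
    unfolding mem_t_closure_iff[OF I] by blast
  then obtain s where s: "s \<in> R - P" "\<forall>x\<in>S. s * x \<in> R"
    using common_denominator[of S] sub by blast
  then have "z * s \<in> R" using S(3) unfolding v_closure_iff by blast
  then show "z \<in> localization R P"
    using s localization_superset_mem[of s z] by (simp add: mult.commute)
qed

text \<open>
  In a domain with \<open>t = v\<close>, the ideal \<open>(R : x\<^sup>-\<^sup>1 R \<inter> R\<^sub>N)\<close> is not contained in \<open>N\<close>: otherwise
  \<open>(R : N) \<subseteq> (x\<^sup>-\<^sup>1 R \<inter> R\<^sub>N)\<^sub>v \<subseteq> R\<^sub>N\<close>, which fails because \<open>N\<close> is divisorial.
\<close>

lemma conductor_not_subset: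
  assumes TV: "TV_domain R" and N: "N \<in> t_Max R" and x: "x \<in> R" "x \<noteq> 0"
  obtains d where "d \<in> R - N" "\<And>z. z \<in> localization R N \<Longrightarrow> z * x \<in> R \<Longrightarrow> d * z \<in> R"
proof -
  interpret prime_of_field_subring R N by (rule t_Max_locale[OF N])
  define L where "L = {z \<in> localization R N. z * x \<in> R}"
  obtain y where y: "y \<notin> R" "\<And>m. m \<in> N \<Longrightarrow> y * m \<in> R" "\<And>s. s \<in> R \<Longrightarrow> s * y \<in> R \<Longrightarrow> s \<in> N"
    by (rule t_Max_witness[OF TV N]) blast
  have "submodule_over R L"
    unfolding submodule_over_def
  proof (intro conjI ballI)
    show "0 \<in> L" using loc.zero_mem zero_mem by (simp add: L_def)
  next
    fix u v assume "u \<in> L" "v \<in> L"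
    then show "u + v \<in> L" using loc.add_mem add_mem by (simp add: L_def distrib_right)
  next
    fix r u assume "r \<in> R" "u \<in> L"
    then show "r * u \<in> L"
      using loc.mult_mem mult_mem subset_localization by (auto simp: L_def mult.assoc)
  qed
  \<comment> \<open>This makes \<open>L\<close> nonzero, and it later forces every multiplier of
    \<open>L\<close> into \<open>R\<close> to lie in \<open>R\<close>.\<close>
  moreover have L1: "1 \<in> L" using x loc.one_mem by (simp add: L_def)
  moreover have "\<forall>z\<in>L. x * z \<in> R" by (simp add: L_def mult.commute)
  ultimately have "nonzero_fractional_ideal R L"
    using x unfolding nonzero_fractional_ideal_def by (metis singletonD zero_neq_one)
  then have vL: "v_closure R L \<subseteq> localization R N"
    by (rule v_closure_subset_localization_TV[OF TV _ t_Max_locale[OF N]]) (auto simp: L_def)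
  have "\<exists>d\<in>R - N. \<forall>z\<in>L. d * z \<in> R"
  proof (rule ccontr)
    assume *: "\<not> (\<exists>d\<in>R - N. \<forall>z\<in>L. d * z \<in> R)"
    have "y \<in> v_closure R L"
      unfolding v_closure_iff
    proof (intro allI impI)
      fix d assume d: "\<forall>z\<in>L. d * z \<in> R"
      then have "d \<in> R" using L1 by force
      then show "y * d \<in> R" using * d y(2) by blast
    qed
    then obtain s where "s \<in> R - N" "s * y \<in> R" using vL mem_localization_iff by blast
    then show False using y(3) by blast
  qed
  then show ?thesis using that unfolding L_def by blast
qed

text \<open>Take \<open>y\<close> with \<open>M\<close> as its ideal of denominators. An element of
  \<open>M\<close> outside \<open>N\<close> puts \<open>y\<close> into \<open>R_N\<close>, and
  \<open>y x\<close> is in \<open>R\<close> because \<open>x\<close> is in \<open>M\<close>; so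
  \<open>d y\<close> is in \<open>R\<close>, which means that \<open>d\<close> is in
  \<open>M\<close>.\<close>

lemma conductor_mem_other:
  assumes TV: "TV_domain R" and M: "M \<in> t_Max R" and N: "N \<in> t_Max R" and "M \<noteq> N"
    and x: "x \<in> M"
    and d: "d \<in> R" "\<And>z. z \<in> localization R N \<Longrightarrow> z * x \<in> R \<Longrightarrow> d * z \<in> R"
  shows "d \<in> M"
proof -
  interpret prime_of_field_subring R N by (rule t_Max_locale[OF N])
  obtain y where y: "y \<notin> R" "\<And>m. m \<in> M \<Longrightarrow> y * m \<in> R" "\<And>s. s \<in> R \<Longrightarrow> s * y \<in> R \<Longrightarrow> s \<in> M"
    by (rule t_Max_witness[OF TV M]) blast
  obtain m where "m \<in> M" "m \<notin> N" using t_Max_antichain[OF M N] \<open>M \<noteq> N\<close> by blast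
  then have "y \<in> localization R N"
    using y(2)[of m] t_MaxD(2)[OF M]
    by (intro localization_superset_mem[of m]) (auto simp: mult.commute)
  then have "d * y \<in> R" using d(2) y(2)[OF x] by blast
  then show ?thesis using y(3) d(1) by blast
qed

text \<open>The elements lying in all but finitely many of the t-maximal ideals that contain
  \<open>x\<close> form a t-ideal \<open>C\<close>. If these ideals were infinite in number,
  \<open>C\<close> would be proper, hence inside some t-maximal \<open>N\<close>. The conductor
  element \<open>d\<close> outside \<open>N\<close> lies in all the others, so it belongs to
  \<open>C\<close>, a contradiction.\<close>

lemma TV_finite_character:
  assumes TV: "TV_domain R" and x: "x \<in> R" "x \<noteq> 0"
  shows "finite {M \<in> t_Max R. x \<in> M}"
proof (rule ccontr)
  assume inf: "infinite {M \<in> t_Max R. x \<in> M}"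
  define C where "C = {r \<in> R. finite {M \<in> t_Max R. x \<in> M \<and> r \<notin> M}}"
  have sub: "submodule_over R C"
    unfolding submodule_over_def
  proof (intro conjI ballI)
    have "{M \<in> t_Max R. x \<in> M \<and> 0 \<notin> M} = {}"
      using submodule_overD(1)[OF t_idealD(2)[OF t_MaxD(1)]] by blast
    then show "0 \<in> C" using zero_mem unfolding C_def by (simp only: finite.emptyI mem_Collect_eq)
  next
    fix a b assume ab: "a \<in> C" "b \<in> C"
    have "{M \<in> t_Max R. x \<in> M \<and> a + b \<notin> M} \<subseteq>
        {M \<in> t_Max R. x \<in> M \<and> a \<notin> M} \<union> {M \<in> t_Max R. x \<in> M \<and> b \<notin> M}"
      using submodule_overD(2)[OF t_idealD(2)[OF t_MaxD(1)]] by blast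
    from finite_subset[OF this] show "a + b \<in> C" using ab add_mem by (simp add: C_def)
  next
    fix r a assume ra: "r \<in> R" "a \<in> C"
    have "{M \<in> t_Max R. x \<in> M \<and> r * a \<notin> M} \<subseteq> {M \<in> t_Max R. x \<in> M \<and> a \<notin> M}"
      using submodule_overD(3)[OF t_idealD(2)[OF t_MaxD(1)]] ra(1) by blast
    from finite_subset[OF this] show "r * a \<in> C" using ra mult_mem by (simp add: C_def)
  qed
  have CR: "C \<subseteq> R" by (auto simp: C_def)
  have "{M \<in> t_Max R. x \<in> M \<and> x \<notin> M} = {}" by blast
  then have xC: "x \<in> C" using x unfolding C_def by (simp only: finite.emptyI mem_Collect_eq)
  have "nonzero_fractional_ideal R C"
    using nonzero_fractional_ideal_integral[OF sub CR xC x(2)] .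
  moreover have "v_closure R S \<subseteq> C" if S: "finite S" "S \<subseteq> C" for S
  proof
    fix z assume z: "z \<in> v_closure R S"
    \<comment> \<open>A t-maximal ideal containing the finite set \<open>S\<close> contains its
      v-closure, so one that omits \<open>z\<close> omits some element of \<open>S\<close>.\<close>
    have "{M \<in> t_Max R. x \<in> M \<and> z \<notin> M} \<subseteq> (\<Union>s\<in>S. {M \<in> t_Max R. x \<in> M \<and> s \<notin> M})"
    proof (rule subsetI, rule ccontr)
      fix M assume M: "M \<in> {M \<in> t_Max R. x \<in> M \<and> z \<notin> M}"
        "M \<notin> (\<Union>s\<in>S. {M \<in> t_Max R. x \<in> M \<and> s \<notin> M})"
      then have "S \<subseteq> M" by blast
      then have "v_closure R S \<subseteq> M" using M t_idealD(4)[OF t_MaxD(1)] S(1) by blast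
      then show False using M z by blast
    qed
    moreover have "finite (\<Union>s\<in>S. {M \<in> t_Max R. x \<in> M \<and> s \<notin> M})"
      using S by (auto simp: C_def)
    ultimately have "finite {M \<in> t_Max R. x \<in> M \<and> z \<notin> M}" by (rule finite_subset)
    moreover have "z \<in> R" using z v_closure_subset[of S] S(2) CR by blast
    ultimately show "z \<in> C" by (simp add: C_def)
  qed
  ultimately have "t_ideal R C" unfolding t_ideal_iff by blast
  moreover have "{M \<in> t_Max R. x \<in> M \<and> 1 \<notin> M} = {M \<in> t_Max R. x \<in> M}"
    using t_MaxD(3) by blast
  then have "1 \<notin> C" using inf by (simp add: C_def)
  ultimately obtain N where N: "N \<in> t_Max R" "C \<subseteq> N"
    using exists_t_Max_superset[OF _ CR] by blast
  obtain d where d: "d \<in> R - N" "\<And>z. z \<in> localization R N \<Longrightarrow> z * x \<in> R \<Longrightarrow> d * z \<in> R"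
    by (rule conductor_not_subset[OF TV N(1) x]) blast
  have "{M \<in> t_Max R. x \<in> M \<and> d \<notin> M} \<subseteq> {N}"
    using conductor_mem_other[OF TV _ N(1) _ _ _ d(2)] d(1) by blast
  then have "d \<in> C" using d(1) finite_subset[of _ "{N}"] by (simp add: C_def)
  then show False using d(1) N(2) by blast
qed

text \<open>
  The element \<open>d\<close> of \<open>(R : x\<^sup>-\<^sup>1 R \<inter> R\<^sub>N) - N\<close> lies in \<open>(d\<^sup>2, x)\<^sub>v\<close>, hence \<open>d \<in> (d\<^sup>2, x) R\<^sub>M\<close>.
  Since \<open>d \<in> M\<close>, this forces \<open>d \<in> x R\<^sub>M\<close>.
\<close>

lemma unique_t_Max_over_prime:
  assumes TV: "TV_domain R"
    and two: "\<And>x d. x \<in> R \<Longrightarrow> x \<noteq> 0 \<Longrightarrow> d \<in> R \<Longrightarrow>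
        v_closure R {d * d, x} \<subseteq> span_over (localization R M) (span_over R {d * d, x})"
    and P: "primeideal P (ring_on R)" "x \<in> P" "x \<noteq> 0"
    and M: "M \<in> t_Max R" "P \<subseteq> M" and N: "N \<in> t_Max R" "P \<subseteq> N"
  shows "M = N"
proof (rule ccontr)
  assume "M \<noteq> N"
  interpret P: prime_of_field_subring R P
    by (simp add: P(1) field_subring_axioms prime_of_field_subring.intro
        prime_of_field_subring_axioms.intro)
  interpret M: prime_of_field_subring R M by (rule t_Max_locale[OF M(1)])
  interpret N: prime_of_field_subring R N by (rule t_Max_locale[OF N(1)])
  have xR: "x \<in> R" using P.subset_ring P(2) by blast
  obtain d where d: "d \<in> R - N" "\<And>z. z \<in> localization R N \<Longrightarrow> z * x \<in> R \<Longrightarrow> d * z \<in> R"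
    by (rule conductor_not_subset[OF TV N(1) xR P(3)]) blast
  have dM: "d \<in> M"
    using conductor_mem_other[OF TV M(1) N(1) \<open>M \<noteq> N\<close> _ _ d(2)] P(2) M(2) d(1) by blast
  \<comment> \<open>If \<open>z d^2\<close> is in \<open>R\<close>, then \<open>z\<close> is in
    \<open>R_N\<close> because \<open>d^2\<close> is outside \<open>N\<close>; if \<open>z x\<close>
    is in \<open>R\<close> as well, the choice of \<open>d\<close> applies to
    \<open>z\<close>.\<close>
  have "d \<in> v_closure R {d * d, x}"
    unfolding v_closure_iff
  proof (intro allI impI)
    fix z assume z: "\<forall>s\<in>{d * d, x}. z * s \<in> R"
    then have "z \<in> localization R N"
      using N.mult_compl[OF d(1) d(1)]
      by (intro N.localization_superset_mem[of "d * d"]) (auto simp: mult.commute)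
    then show "d * z \<in> R" using d(2) z by blast
  qed
  then have "d \<in> span_over (localization R M) (span_over R {d * d, x})"
    using two[OF xR P(3)] d(1) by blast
  then obtain s where s: "s \<in> R - M" "s * d \<in> span_over R {d * d, x}"
    unfolding M.mem_span_localization_iff[OF submodule_span] by blast
  \<comment> \<open>The explicit form of the span also covers the case \<open>d * d = x\<close>,
    where there is only one generator.\<close>
  have "span_over R {d * d, x} \<subseteq> {a * (d * d) + b * x | a b. a \<in> R \<and> b \<in> R}"
  proof (rule span_over_least)
    show "submodule_over R {a * (d * d) + b * x | a b. a \<in> R \<and> b \<in> R}"
      unfolding submodule_over_def
    proof (intro conjI ballI)
      show "0 \<in> {a * (d * d) + b * x | a b. a \<in> R \<and> b \<in> R}"
        using zero_mem by force
    next
      fix u v assume "u \<in> {a * (d * d) + b * x | a b. a \<in> R \<and> b \<in> R}"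
        "v \<in> {a * (d * d) + b * x | a b. a \<in> R \<and> b \<in> R}"
      then obtain a b a' b' where "a \<in> R" "b \<in> R" "a' \<in> R" "b' \<in> R"
        "u = a * (d * d) + b * x" "v = a' * (d * d) + b' * x" by blast
      moreover then have "u + v = (a + a') * (d * d) + (b + b') * x"
        by (simp add: algebra_simps)
      ultimately show "u + v \<in> {a * (d * d) + b * x | a b. a \<in> R \<and> b \<in> R}"
        using add_mem[of a a'] add_mem[of b b'] by auto
    next
      fix r u assume "r \<in> R" "u \<in> {a * (d * d) + b * x | a b. a \<in> R \<and> b \<in> R}"
      then obtain a b where "a \<in> R" "b \<in> R" "u = a * (d * d) + b * x" by blast
      moreover then have "r * u = (r * a) * (d * d) + (r * b) * x"
        by (simp add: algebra_simps)
      ultimately show "r * u \<in> {a * (d * d) + b * x | a b. a \<in> R \<and> b \<in> R}"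
        using mult_mem[of r a] mult_mem[of r b] \<open>r \<in> R\<close> by auto
    qed
    have "d * d = 1 * (d * d) + 0 * x" "x = 0 * (d * d) + 1 * x" by simp_all
    then show "{d * d, x} \<subseteq> {a * (d * d) + b * x | a b. a \<in> R \<and> b \<in> R}"
      using zero_mem one_mem by blast
  qed
  then obtain a b where ab: "a \<in> R" "b \<in> R" "s * d = a * (d * d) + b * x" using s(2) by blast
  \<comment> \<open>The right side lies in the prime \<open>P\<close>, yet neither factor does:
    \<open>d\<close> is outside \<open>N\<close>, and \<open>s - a d\<close> is outside
    \<open>M\<close> because \<open>d\<close> is in \<open>M\<close> and \<open>s\<close> is
    not.\<close>
  have "d * (s - a * d) = b * x" using ab(3) by (simp add: algebra_simps)
  then have "d * (s - a * d) \<in> P" using P.mult_left[OF ab(2) P(2)] by simp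
  moreover have "s - a * d \<in> R" using s(1) ab d(1) diff_mem mult_mem by blast
  ultimately have "d \<in> P \<or> s - a * d \<in> P" using P.mult_cases d(1) by blast
  moreover have "d \<notin> P" using d(1) N(2) by blast
  moreover have "s - a * d \<notin> M"
  proof
    assume "s - a * d \<in> M"
    then have "(s - a * d) + a * d \<in> M"
      using submodule_overD(2)[OF M.submodule] M.mult_left[OF ab(1) dM] by blast
    then show False using s(1) by simp
  qed
  ultimately show False using M(2) by blast
qed

text \<open>The hypothesis \<open>two\<close> isolates what w-divisoriality, and alternatively
  \<open>t = v\<close> with divisorial localizations, contribute; both routes to the weakly Matlis
  property pass through it.\<close>

lemma weakly_Matlis_if_unique:
  assumes TV: "TV_domain R"
    and two: "\<And>M x d. M \<in> t_Max R \<Longrightarrow> x \<in> R \<Longrightarrow> x \<noteq> 0 \<Longrightarrow> d \<in> R \<Longrightarrow>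
        v_closure R {d * d, x} \<subseteq> span_over (localization R M) (span_over R {d * d, x})"
  shows "weakly_Matlis_domain R"
  unfolding weakly_Matlis_domain_def
proof (intro conjI ballI allI impI)
  fix P assume P: "t_prime R P"
  then have tP: "t_ideal R P" and prime: "primeideal P (ring_on R)"
    unfolding t_prime_def by blast+
  obtain x where x: "x \<in> P" "x \<noteq> 0" using t_idealD(3)[OF tP] by blast
  obtain M where M: "M \<in> t_Max R" "P \<subseteq> M"
    using exists_t_Max_superset[OF tP] prime unfolding primeideal_on_iff by blast
  show "\<exists>!M. M \<in> t_Max R \<and> P \<subseteq> M"
  proof (rule ex1I[of _ M])
    fix N assume "N \<in> t_Max R \<and> P \<subseteq> N"
    then show "N = M"
      using unique_t_Max_over_prime[OF TV two prime x M, of N] M(1) by blast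
  qed (use M in blast)
qed (rule TV_finite_character[OF TV])

section \<open>Independence of t-maximal ideals in a weakly Matlis domain\<close>

text \<open>If the principal ideal of \<open>b\<close> missed all products of an element outside
  \<open>N\<close> with one outside \<open>M\<close>, a t-ideal maximal with this property would be
  a t-prime contained in both \<open>M\<close> and \<open>N\<close>. So some \<open>p q\<close> is
  divisible by \<open>b\<close>, and \<open>p\<close> is a denominator for \<open>q / b\<close> in
  \<open>R_N\<close>.\<close>

lemma weakly_Matlis_separated:
  assumes wM: "weakly_Matlis_domain R" and M: "M \<in> t_Max R" and N: "N \<in> t_Max R" and "M \<noteq> N"
    and b: "b \<in> R" "b \<noteq> 0"
  shows "\<exists>q\<in>R - M. q / b \<in> localization R N"
proof -
  interpret M: prime_of_field_subring R M by (rule t_Max_locale[OF M])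
  interpret N: prime_of_field_subring R N by (rule t_Max_locale[OF N])
  define S where "S = {p * q | p q. p \<in> R - N \<and> q \<in> R - M}"
  have S1: "1 \<in> S" using M.one_compl N.one_compl unfolding S_def by force
  have SR: "S \<subseteq> R" using mult_mem unfolding S_def by blast
  have SS: "u * v \<in> S" if uv: "u \<in> S" "v \<in> S" for u v
  proof -
    from uv obtain p q p' q' where "p \<in> R - N" "q \<in> R - M" "p' \<in> R - N" "q' \<in> R - M"
      "u = p * q" "v = p' * q'" unfolding S_def by blast
    moreover then have "u * v = (p * p') * (q * q')" by (simp add: ac_simps)
    ultimately show ?thesis
      using M.mult_compl N.mult_compl unfolding S_def by blast
  qed
  have SN: "R - N \<subseteq> S" using M.one_compl unfolding S_def by force
  have SM: "R - M \<subseteq> S" using N.one_compl unfolding S_def by force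
  have "v_closure R {b} \<inter> S \<noteq> {}"
  proof
    assume disj: "v_closure R {b} \<inter> S = {}"
    have vR: "v_closure R {b} \<subseteq> R" using b(1) by (intro v_closure_subset) simp
    obtain Q where Q: "t_ideal R Q" "v_closure R {b} \<subseteq> Q" "Q \<subseteq> R" "Q \<inter> S = {}"
      "\<And>J. t_ideal R J \<Longrightarrow> J \<subseteq> R \<Longrightarrow> J \<inter> S = {} \<Longrightarrow> Q \<subseteq> J \<Longrightarrow> J = Q"
      by (rule exists_maximal_t_ideal[OF t_ideal_v_closure_singleton[OF b(2)] vR disj]) blast
    have "primeideal Q (ring_on R)"
      by (rule maximal_t_ideal_prime[OF S1 SR SS Q(1,3,4,5)])
    then have "\<exists>!M. M \<in> t_Max R \<and> Q \<subseteq> M"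
      using wM Q(1) unfolding weakly_Matlis_domain_def t_prime_def by blast
    moreover have "Q \<subseteq> M" "Q \<subseteq> N" using Q(3,4) SM SN by blast+
    ultimately show False using M N \<open>M \<noteq> N\<close> by blast
  qed
  then obtain p q where pq: "p \<in> R - N" "q \<in> R - M" "p * q \<in> v_closure R {b}"
    unfolding S_def by blast
  then have "p * (q / b) \<in> R" using mem_v_closure_singletonD[OF pq(3) b(2)] by simp
  then show ?thesis using pq N.localization_superset_mem by blast
qed

text \<open>Write \<open>z = a / b\<close>. Finite character leaves finitely many \<open>N\<close>
  containing \<open>b\<close> to treat, one factor from the separation lemma for each; at every
  other \<open>N\<close> the inverse of \<open>b\<close> is already present.\<close>

lemma weakly_Matlis_independent:
  assumes wM: "weakly_Matlis_domain R" and M: "M \<in> t_Max R"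
  obtains s where "s \<in> R - M" "\<And>N. N \<in> t_Max R \<Longrightarrow> N \<noteq> M \<Longrightarrow> s * z \<in> localization R N"
proof -
  interpret M: prime_of_field_subring R M by (rule t_Max_locale[OF M])
  obtain a b where ab: "a \<in> R" "b \<in> R" "b \<noteq> 0" "z = a / b" by (rule fraction_cases)
  have "\<exists>s\<in>R - M. \<forall>N\<in>F. s / b \<in> localization R N" if "finite F" "F \<subseteq> t_Max R - {M}" for F
    using that
  proof (induction F rule: finite_induct)
    case empty
    then show ?case using M.one_compl by blast
  next
    case (insert N F)
    then obtain s where s: "s \<in> R - M" "\<forall>N\<in>F. s / b \<in> localization R N" by auto
    have N: "N \<in> t_Max R" "M \<noteq> N" using insert.prems by auto
    obtain q where q: "q \<in> R - M" "q / b \<in> localization R N"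
      using weakly_Matlis_separated[OF wM M N ab(2,3)] by blast
    have "(s * q) / b \<in> localization R L" if "L \<in> insert N F" for L
    proof -
      have "L \<in> t_Max R" using that insert.prems by blast
      then interpret L: prime_of_field_subring R L by (rule t_Max_locale)
      show ?thesis
      proof (cases "L = N")
        case True
        have "s * (q / b) \<in> localization R L"
          using s(1) q(2) L.subset_localization True by (intro L.loc.mult_mem) auto
        then show ?thesis by simp
      next
        case False
        then have "q * (s / b) \<in> localization R L"
          using s(2) q(1) L.subset_localization that by (intro L.loc.mult_mem) auto
        then show ?thesis by (simp add: mult.commute)
      qed
    qed
    then show ?case using M.mult_compl[OF s(1) q(1)] by blast
  qed
  moreover have "finite ({N \<in> t_Max R. b \<in> N} - {M})"
    using wM ab(2,3) unfolding weakly_Matlis_domain_def by blast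
  ultimately obtain s where s: "s \<in> R - M"
    "\<forall>N\<in>{N \<in> t_Max R. b \<in> N} - {M}. s / b \<in> localization R N"
    by (metis (no_types, lifting) Diff_mono mem_Collect_eq order_refl subsetI)
  show ?thesis
  proof (rule that[OF s(1)])
    fix N assume N: "N \<in> t_Max R" "N \<noteq> M"
    interpret N: prime_of_field_subring R N by (rule t_Max_locale[OF N(1)])
    have "s / b \<in> localization R N"
    proof (cases "b \<in> N")
      case False
      then show ?thesis
        using s(1) ab(2) N.subset_localization by (intro N.divide_mem_localization) auto
    qed (use s(2) N in blast)
    then have "a * (s / b) \<in> localization R N"
      using ab(1) N.subset_localization by (intro N.loc.mult_mem) auto
    then show "s * z \<in> localization R N" using ab(4) by (simp add: mult.commute)
  qed
qed

section \<open>Divisorial localizations\<close>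

text \<open>A divisorial domain is defined through integral ideals only. A common denominator
  \<open>q\<close> of \<open>I\<close> makes \<open>q I R_M\<close> integral, and scaling by
  \<open>q\<close> commutes with the v-closure.\<close>

lemma divisorial_localization_v_closure:
  assumes div: "divisorial_domain (localization R M)" and M: "M \<in> t_Max R"
    and I: "nonzero_fractional_ideal R I"
  shows "v_closure (localization R M) (span_over (localization R M) I) =
    span_over (localization R M) I"
proof -
  interpret prime_of_field_subring R M by (rule t_Max_locale[OF M])
  note subm = nonzero_fractional_idealD(1)[OF I]
  define A where "A = span_over (localization R M) I"
  obtain q where q: "q \<in> R" "q \<noteq> 0" "\<forall>x\<in>I. q * x \<in> R"
    using nonzero_fractional_idealD(3)[OF I] by blast
  obtain i where i: "i \<in> I" "i \<noteq> 0" using nonzero_fractional_idealD(2)[OF I] by blast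
  have Asub: "submodule_over (localization R M) A" unfolding A_def by (rule loc.submodule_span)
  have "(*) q ` A \<subseteq> localization R M"
  proof clarify
    fix x assume "x \<in> A"
    then obtain s where s: "s \<in> R - M" "s * x \<in> I"
      unfolding A_def mem_span_localization_iff[OF subm] by blast
    then have "s * (q * x) \<in> R" using q(3) by (simp add: mult.left_commute)
    then show "q * x \<in> localization R M" using s(1) localization_superset_mem by blast
  qed
  moreover have "submodule_over (localization R M) ((*) q ` A)"
    unfolding submodule_over_def
  proof (intro conjI ballI)
    show "0 \<in> (*) q ` A" using submodule_overD(1)[OF Asub] by force
  next
    fix u v assume "u \<in> (*) q ` A" "v \<in> (*) q ` A"
    then obtain u' v' where "u = q * u'" "v = q * v'" "u' \<in> A" "v' \<in> A" by blast
    then show "u + v \<in> (*) q ` A"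
      using submodule_overD(2)[OF Asub] by (intro image_eqI[of _ _ "u' + v'"]) (auto simp: distrib_left)
  next
    fix r u assume "r \<in> localization R M" "u \<in> (*) q ` A"
    then obtain u' where "u = q * u'" "u' \<in> A" by blast
    then show "r * u \<in> (*) q ` A"
      using submodule_overD(3)[OF Asub] \<open>r \<in> localization R M\<close>
      by (intro image_eqI[of _ _ "r * u'"]) (auto simp: mult.left_commute)
  qed
  moreover have "q * i \<in> (*) q ` A" using i loc.span_superset[of I] unfolding A_def by blast
  then have "(*) q ` A \<noteq> {0}" using q(2) i(2) by (metis mult_eq_0_iff singletonD)
  ultimately have "(*) q ` A = v_closure (localization R M) ((*) q ` A)"
    using div loc.ideal_on_iff unfolding divisorial_domain_def divisorial_ideal_def by blast
  also have "\<dots> = (*) q ` v_closure (localization R M) A" using q(2) by (rule v_closure_scale)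
  finally have "v_closure (localization R M) A = A"
    using inj_image_eq_iff[of "(*) q"] q(2) by (metis injI mult_left_cancel)
  then show ?thesis unfolding A_def .
qed

text \<open>It suffices that an element of the v-closure of \<open>I\<close> stays in the v-closure
  of \<open>I R_M\<close>. For this, each \<open>y\<close> multiplying \<open>I\<close> into
  \<open>R_M\<close> is moved by a factor outside \<open>M\<close> to one multiplying
  \<open>I\<close> into \<open>R\<close>.\<close>

lemma w_divisorial_if_divisorial_localizations:
  assumes wM: "weakly_Matlis_domain R"
    and div: "\<forall>M\<in>t_Max R. divisorial_domain (localization R M)"
  shows "w_divisorial_domain R"
  unfolding w_divisorial_domain_iff
proof (intro allI impI subsetI)
  fix I z assume I: "nonzero_fractional_ideal R I" and z: "z \<in> v_closure R I"
  note subm = nonzero_fractional_idealD(1)[OF I]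
  obtain q where q: "q \<in> R" "q \<noteq> 0" "\<forall>x\<in>I. q * x \<in> R"
    using nonzero_fractional_idealD(3)[OF I] by blast
  show "z \<in> w_closure R I"
    unfolding w_closure_def
  proof
    fix M assume M: "M \<in> t_Max R"
    interpret prime_of_field_subring R M by (rule t_Max_locale[OF M])
    have "z \<in> v_closure (localization R M) (span_over (localization R M) I)"
      unfolding loc.v_closure_span v_closure_iff
    proof (intro allI impI)
      fix y assume y: "\<forall>x\<in>I. y * x \<in> localization R M"
      \<comment> \<open>Independence is applied to \<open>y / q\<close>, not to \<open>y\<close>: as
        \<open>q x\<close> is in \<open>R\<close> for all \<open>x\<close> in \<open>I\<close>, this
        one \<open>s\<close> works for the whole of \<open>I\<close>.\<close>
      obtain s where s: "s \<in> R - M"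
        "\<And>N. N \<in> t_Max R \<Longrightarrow> N \<noteq> M \<Longrightarrow> s * (y / q) \<in> localization R N"
        by (rule weakly_Matlis_independent[OF wM M]) blast
      have "(s * y) * x \<in> R" if x: "x \<in> I" for x
        unfolding mem_ring_iff_localizations
      proof
        fix N assume N: "N \<in> t_Max R"
        interpret N: prime_of_field_subring R N by (rule t_Max_locale[OF N])
        show "(s * y) * x \<in> localization R N"
        proof (cases "N = M")
          case True
          have "s * (y * x) \<in> localization R N"
            unfolding True using loc.mult_mem[of s "y * x"] s(1) y x subset_localization by blast
          then show ?thesis by (simp add: mult.assoc)
        next
          case False
          then have "(s * (y / q)) * (q * x) \<in> localization R N"
            using N.loc.mult_mem[of "s * (y / q)" "q * x"] s(2)[OF N] q(3) x N.subset_localization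
            by blast
          then show ?thesis using q(2) by (simp add: mult.assoc)
        qed
      qed
      then have "z * (s * y) \<in> R" using z unfolding v_closure_iff by blast
      then show "z * y \<in> localization R M"
        using s(1) by (intro localization_superset_mem[of s]) (simp_all add: ac_simps)
    qed
    then show "z \<in> span_over (localization R M) I"
      using divisorial_localization_v_closure[OF _ M I] div M by blast
  qed
qed

text \<open>An element \<open>z\<close> of the v-closure of \<open>A\<close> outside
  \<open>A\<close> is compared with the contraction \<open>I\<close> of \<open>A\<close> to
  \<open>R\<close>. A multiple \<open>s z\<close> escapes the w-closure of \<open>I\<close>, hence
  its v-closure, so some \<open>y\<close> multiplies \<open>I\<close> into \<open>R\<close> but not
  \<open>s z\<close>. Checking \<open>s z y\<close> at every t-maximal ideal contradicts
  this.\<close>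

lemma w_divisorial_imp_divisorial_localization:
  assumes w: "w_divisorial_domain R" and wM: "weakly_Matlis_domain R" and M: "M \<in> t_Max R"
  shows "divisorial_domain (localization R M)"
  unfolding divisorial_domain_def
proof (intro allI impI)
  interpret prime_of_field_subring R M by (rule t_Max_locale[OF M])
  fix A assume "ideal A (ring_on (localization R M)) \<and> A \<noteq> {0}"
  then have AR: "A \<subseteq> localization R M" and A: "submodule_over (localization R M) A" and "A \<noteq> {0}"
    unfolding loc.ideal_on_iff by blast+
  then have "\<exists>x0\<in>A. x0 \<noteq> 0" using submodule_overD(1)[OF A] by blast
  then obtain x0 where x0: "x0 \<in> A" "x0 \<noteq> 0" by blast
  then obtain t where t: "t \<in> R - M" "t * x0 \<in> R" using AR mem_localization_iff by blast
  define x where "x = t * x0"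
  have x: "x \<in> A" "x \<in> R" "x \<noteq> 0"
    using t x0 submodule_overD(3)[OF A, of t x0] subset_localization compl_nonzero[OF t(1)]
    by (auto simp: x_def)
  define I where "I = A \<inter> R"
  have subm: "submodule_over R I"
    using A submodule_self subset_localization unfolding I_def submodule_over_def by blast
  have I: "nonzero_fractional_ideal R I"
    using nonzero_fractional_ideal_integral[OF subm _ _ x(3)] x unfolding I_def by blast
  have "v_closure (localization R M) A \<subseteq> A"
  proof
    fix z assume z: "z \<in> v_closure (localization R M) A"
    show "z \<in> A"
    proof (rule ccontr)
      assume "z \<notin> A"
      \<comment> \<open>Dividing by the nonzero element \<open>x\<close> of \<open>I\<close> lets
        one \<open>s\<close> serve for every later \<open>y\<close>, since \<open>y x\<close> will
        be in \<open>R\<close>.\<close>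
      obtain s where s: "s \<in> R - M"
        "\<And>N. N \<in> t_Max R \<Longrightarrow> N \<noteq> M \<Longrightarrow> s * (z / x) \<in> localization R N"
        by (rule weakly_Matlis_independent[OF wM M]) blast
      \<comment> \<open>Otherwise an element outside \<open>M\<close> would multiply
        \<open>z\<close> into \<open>A\<close>; it is a unit of \<open>R_M\<close>, so
        \<open>z\<close> would be in \<open>A\<close>.\<close>
      have "s * z \<notin> w_closure R I"
      proof
        assume "s * z \<in> w_closure R I"
        then obtain r where r: "r \<in> R - M" "r * (s * z) \<in> I"
          using M unfolding mem_w_closure_iff[OF subm] by blast
        have "r * s \<in> R - M" using mult_compl[OF r(1) s(1)] .
        moreover have "(r * s) * z \<in> A" using r(2) unfolding I_def by (simp add: mult.assoc)
        ultimately have "inverse (r * s) * ((r * s) * z) \<in> A"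
          using submodule_overD(3)[OF A] inverse_mem_localization by blast
        moreover have "inverse u * (u * z) = z" if "u \<noteq> 0" for u
          using that by (simp add: mult.assoc[symmetric])
        ultimately show False
          using \<open>z \<notin> A\<close> compl_nonzero[OF \<open>r * s \<in> R - M\<close>] by metis
      qed
      then have "s * z \<notin> v_closure R I" using w I unfolding w_divisorial_domain_iff by blast
      then obtain y where y: "\<forall>i\<in>I. y * i \<in> R" "(s * z) * y \<notin> R"
        unfolding v_closure_iff by blast
      have "y * a \<in> localization R M" if "a \<in> A" for a
      proof -
        have "a \<in> localization R M" using that AR by (rule rev_subsetD)
        then obtain r where r: "r \<in> R - M" "r * a \<in> R" unfolding mem_localization_iff by (rule bexE)
        then have "r * a \<in> I"
          using submodule_overD(3)[OF A _ that, of r] subset_localization[THEN subsetD, of r]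
          by (simp add: I_def)
        then have "y * (r * a) \<in> R" using y(1) by blast
        then show ?thesis
          using r(1) by (intro localization_superset_mem[of r]) (simp_all add: ac_simps)
      qed
      then have "z * y \<in> localization R M" using z unfolding v_closure_iff by blast
      then have "s * (z * y) \<in> localization R M"
        using loc.mult_mem[of s "z * y"] s(1) subset_localization by blast
      then have atM: "(s * z) * y \<in> localization R M" by (simp add: mult.assoc)
      \<comment> \<open>At \<open>M\<close> this is \<open>atM\<close>; at any other
        \<open>N\<close> the product factors as \<open>y x\<close> in \<open>R\<close> times
        \<open>s z / x\<close> in \<open>R_N\<close>.\<close>
      have "(s * z) * y \<in> R"
        unfolding mem_ring_iff_localizations
      proof
        fix N assume N: "N \<in> t_Max R"
        interpret N: prime_of_field_subring R N by (rule t_Max_locale[OF N])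
        show "(s * z) * y \<in> localization R N"
        proof (cases "N = M")
          case False
          have "y * x \<in> R" using y(1) x unfolding I_def by blast
          then have "(y * x) * (s * (z / x)) \<in> localization R N"
            using N.loc.mult_mem[of "y * x" "s * (z / x)"] s(2)[OF N False] N.subset_localization
            by blast
          then show ?thesis using x(3) by (simp add: ac_simps)
        qed (use atM in simp)
      qed
      then show False using y(2) by blast
    qed
  qed
  moreover have "nonzero_fractional_ideal (localization R M) A"
    using A AR \<open>A \<noteq> {0}\<close> loc.one_mem unfolding nonzero_fractional_ideal_def
    by (metis mult_1 subsetD zero_neq_one)
  ultimately show "divisorial_ideal (localization R M) A"
    using subset_v_closure unfolding divisorial_ideal_def by blast
qed

section \<open>The implications assembled\<close>

lemma nonzero_fractional_ideal_pair:
  assumes "d \<in> R" "x \<in> R" "x \<noteq> 0"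
  shows "nonzero_fractional_ideal R (span_over R {d * d, x})"
proof (rule nonzero_fractional_ideal_integral[OF submodule_span])
  show "span_over R {d * d, x} \<subseteq> R"
    using assms mult_mem by (intro span_over_least submodule_self) auto
  show "x \<in> span_over R {d * d, x}" using span_superset by blast
qed (rule assms)

lemma w_divisorial_imp_weakly_Matlis:
  assumes w: "w_divisorial_domain R"
  shows "weakly_Matlis_domain R"
proof (rule weakly_Matlis_if_unique[OF w_divisorial_imp_TV[OF w]])
  fix M x d assume M: "M \<in> t_Max R" and xd: "x \<in> R" "x \<noteq> 0" "d \<in> R"
  have "v_closure R {d * d, x} \<subseteq> w_closure R (span_over R {d * d, x})"
    using w nonzero_fractional_ideal_pair[OF xd(3,1,2)]
    unfolding w_divisorial_domain_iff by (metis v_closure_span)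
  then show "v_closure R {d * d, x} \<subseteq> span_over (localization R M) (span_over R {d * d, x})"
    using M unfolding w_closure_def by blast
qed

text \<open>For a finite set the v-closure in \<open>R\<close> is contained in the one in
  \<open>R_M\<close>, and there divisoriality collapses it to the extended ideal.\<close>

lemma TV_divisorial_imp_weakly_Matlis:
  assumes TV: "TV_domain R" and div: "\<forall>M\<in>t_Max R. divisorial_domain (localization R M)"
  shows "weakly_Matlis_domain R"
proof (rule weakly_Matlis_if_unique[OF TV])
  fix M x d assume M: "M \<in> t_Max R" and xd: "x \<in> R" "x \<noteq> 0" "d \<in> R"
  interpret prime_of_field_subring R M by (rule t_Max_locale[OF M])
  let ?J = "span_over R {d * d, x}"
  have "v_closure R {d * d, x} \<subseteq> v_closure (localization R M) {d * d, x}"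
    by (intro v_closure_subset_localization) simp
  also have "\<dots> \<subseteq> v_closure (localization R M) (span_over (localization R M) ?J)"
    using span_superset loc.span_superset by (intro v_closure_mono) blast
  also have "\<dots> = span_over (localization R M) ?J"
    using div M nonzero_fractional_ideal_pair[OF xd(3,1,2)]
    by (intro divisorial_localization_v_closure) auto
  finally show "v_closure R {d * d, x} \<subseteq> span_over (localization R M) ?J" .
qed

text \<open>Divisoriality of \<open>R_M\<close> gives the first equality, and the inclusion of the
  v-closure in every \<open>I R_M\<close> gives the second. Conversely, the two equalities place the
  v-closure of \<open>I\<close> in each \<open>I R_M\<close>, hence in the w-closure.\<close>

lemma w_divisorial_iff_localizations:
  "w_divisorial_domain R \<longleftrightarrow>
    (\<forall>I M. nonzero_fractional_ideal R I \<and> M \<in> t_Max R \<longrightarrow>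
       span_over (localization R M) I
         = v_closure (localization R M) (span_over (localization R M) I) \<and>
       v_closure (localization R M) (span_over (localization R M) I)
         = span_over (localization R M) (v_closure R I))"
  (is "_ \<longleftrightarrow> ?loc")
proof
  assume w: "w_divisorial_domain R"
  have wM: "weakly_Matlis_domain R" by (rule w_divisorial_imp_weakly_Matlis[OF w])
  show ?loc
  proof (intro allI impI, elim conjE)
    fix I M assume I: "nonzero_fractional_ideal R I" and M: "M \<in> t_Max R"
    interpret prime_of_field_subring R M by (rule t_Max_locale[OF M])
    have v: "v_closure (localization R M) (span_over (localization R M) I) =
        span_over (localization R M) I"
      by (rule divisorial_localization_v_closure[OF _ M I])
        (rule w_divisorial_imp_divisorial_localization[OF w wM M])
    have "v_closure R I \<subseteq> span_over (localization R M) I"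
      using w I M unfolding w_divisorial_domain_iff w_closure_def by blast
    then have "span_over (localization R M) (v_closure R I) \<subseteq> span_over (localization R M) I"
      by (intro span_over_least loc.submodule_span)
    moreover have "span_over (localization R M) I \<subseteq> span_over (localization R M) (v_closure R I)"
      by (intro span_over_mono subset_v_closure)
    ultimately show "span_over (localization R M) I
         = v_closure (localization R M) (span_over (localization R M) I) \<and>
       v_closure (localization R M) (span_over (localization R M) I)
         = span_over (localization R M) (v_closure R I)"
      using v by blast
  qed
next
  assume *: ?loc
  show "w_divisorial_domain R"
    unfolding w_divisorial_domain_iff w_closure_def
  proof (intro allI impI INT_greatest)
    fix I M assume I: "nonzero_fractional_ideal R I" and M: "M \<in> t_Max R"
    interpret prime_of_field_subring R M by (rule t_Max_locale[OF M])
    have "v_closure R I \<subseteq> span_over (localization R M) (v_closure R I)"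
      by (rule loc.span_superset)
    then show "v_closure R I \<subseteq> span_over (localization R M) I" using * I M by metis
  qed
qed

end

lemma field_subring_if_domain:
  assumes "domain (ring_on R)"
  shows "field_subring R"
proof -
  interpret domain "ring_on R" by (rule assms)
  have plus: "a \<oplus>\<^bsub>ring_on R\<^esub> b = a + b" and zero: "\<zero>\<^bsub>ring_on R\<^esub> = 0"
    and carrier: "carrier (ring_on R) = R" for a b
    by (simp_all add: ring_on_def)
  show ?thesis
  proof
    fix a assume a: "a \<in> R"
    then have "a + \<ominus>\<^bsub>ring_on R\<^esub> a = 0" using r_neg[of a] by (simp add: carrier plus zero)
    then have "\<ominus>\<^bsub>ring_on R\<^esub> a = - a" by (simp add: add_eq_0_iff)
    then show "- a \<in> R" using a a_inv_closed[of a] by (simp add: carrier)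
  qed (use zero_closed one_closed a_closed m_closed in \<open>simp_all add: ring_on_def\<close>)
qed

theorem theorem1p5:
  fixes R :: "'k::field set"
  assumes "domain (ring_on R)"
    and "has_quotient_field_UNIV R"
    and "R \<noteq> UNIV"
  shows
    "(w_divisorial_domain R \<longleftrightarrow>
        weakly_Matlis_domain R \<and> (\<forall>M\<in>t_Max R. divisorial_domain (localization R M))) \<and>
     (w_divisorial_domain R \<longleftrightarrow>
        TV_domain R \<and> (\<forall>M\<in>t_Max R. divisorial_domain (localization R M))) \<and>
     (w_divisorial_domain R \<longleftrightarrow>
        (\<forall>I M. nonzero_fractional_ideal R I \<and> M \<in> t_Max R \<longrightarrow>
           span_over (localization R M) I
             = v_closure (localization R M) (span_over (localization R M) I) \<and>
           v_closure (localization R M) (span_over (localization R M) I)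
             = span_over (localization R M) (v_closure R I)))"
proof -
  interpret fraction_domain R
    by (intro fraction_domain.intro fraction_domain_axioms.intro field_subring_if_domain assms)
  show ?thesis
    using w_divisorial_imp_weakly_Matlis w_divisorial_imp_TV w_divisorial_imp_divisorial_localization
      TV_divisorial_imp_weakly_Matlis w_divisorial_if_divisorial_localizations
      w_divisorial_iff_localizations
    by (intro conjI) blast+
qed

end
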